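(* Let $\xi(a,b)$ denote the asymptotic coverage density of the trapezium parking model with parameters $0\le b\le a<\infty$, $a>0$. The function $x\mapsto\xi(1,x)$ defined on $[0,1]$ has a unique minimiser $x^\ast\in(0,1)$, i.e. a unique $x^\ast$ such that $\xi(1,x^\ast)=\inf_{x\in[0,1]}\xi(1,x)$.
   Context: Fix reals $0\le b\le a<\infty$ with $a>0$. "Trapezium" means isosceles trapezium (degenerating to a triangle if $b=0$ and a rectangle if $a=b$). Strips. $\mathcal{T}_x$ is the trapezium of height $1$ with lower base of length $x+(a-b)/2$ and upper base of length $x-(a-b)/2$. $\mathcal{P}_x$ is the parallelogram of height $1$ with two horizontal parallel sides of length $x$ and acute angle $\arctan(2/(a-b))$ (and $\pi/2$ if $a=b$), whose left-most point is on the upper line. Both have area $x$. The deposited particle is a copy of $\mathcal{T}_{(a+b)/2}$ (bases $a$ and $b$, height $1$), placed with its longer base on the upper line ("up") or on the lower line ("down") of the strip; its position is given by the distance from the left end of that line to the left endpoint of the longer base. Uniform depositing algorithm (UDA). On $\mathcal{P}_x$ with $x>a$: draw $\tau\sim\mathcal{U}(0,2x-2a)$. If $\tau\in(0,x-a)$, deposit up at position $\tau$; the remaining region consists of two strips $\mathcal{P}_\tau$ and $\mathcal{T}_{x-\tau-(a+b)/2}$. If $\tau\in[x-a,2x-2a)$, deposit down at position $y=\tau+a-x$; the remaining strips are $\mathcal{T}_{t}$ and $\mathcal{P}_{x-t-(a+b)/2}$ with $t=y+(a-b)/2$. On $\mathcal{T}_x$ with $(a+b)/2<x<(3a-b)/2$: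 draw $\tau\sim\mathcal{U}(0,x-(a+b)/2)$ and deposit down at position $\tau$; the remaining strips are $\mathcal{P}_\tau$ and $\mathcal{P}_{x-\tau-(a+b)/2}$. On $\mathcal{T}_x$ with $x\ge(3a-b)/2$ (and $x>(a+b)/2$): draw $\tau\sim\mathcal{U}(0,2x-2a)$. If $\tau\in(0,x-(3a-b)/2)$, deposit up at position $\tau$; the remaining strips are $\mathcal{T}_{\tau+(a-b)/2}$ and $\mathcal{T}_{x-\tau-a}$. If $\tau\in[x-(3a-b)/2,2x-2a)$, deposit down at position $y=\tau-(x-(3a-b)/2)$; the remaining strips are $\mathcal{P}_y$ and $\mathcal{P}_{x-y-(a+b)/2}$. (Strips are identified up to reflection.) Conditionally on the first deposition, the procedure continues on the two remaining strips with independent copies of the UDA, recursively, until no remaining strip can fit $\mathcal{T}_{(a+b)/2}$. $P_x$ (resp. $T_x$) is the total number of particles deposited on $\mathcal{P}_x$ (resp. $\mathcal{T}_x$). Conventions: $P_x=0$ for $x\in[0,a)$, $P_a=1$, $T_x=0$ for $x\in[0,(a+b)/2)$, $T_{(a+b)/2}=1$. Set $\eta(x)=\tfrac12(\mathbb{E}[P_x]+\mathbb{E}[T_x])$, $\lambda(a,b)=\lim_{x\to\infty}\eta(x)/x$ (this limit exists in $(0,\infty)$), and $\xi(a,b)=\lambda(a,b)(a+b)/2$. *)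

theory Defs
  imports "HOL-Probability.Probability"
begin

text \<open>
  Trapezium parking by the uniform depositing algorithm (UDA). All strips have height 1, so that a
  strip is determined, up to reflection, by its shape and its area, given the particle parameters
  \<open>a\<close> and \<open>b\<close>: \<open>Para x\<close> is the parallelogram with horizontal sides of length \<open>x\<close> and acute angle
  \<open>arctan (2 / (a - b))\<close>, and \<open>Trap x\<close> is the isosceles trapezium with bases \<open>x + (a - b) / 2\<close> and
  \<open>x - (a - b) / 2\<close>. The particle is a copy of \<open>Trap ((a + b) / 2)\<close>. Areas outside the geometrically
  meaningful range never arise from strips inside it.
\<close>

datatype strip = Para real | Trap real

fun area :: "strip \<Rightarrow> real" where
  "area (Para x) = x"
| "area (Trap x) = x"

definition uniform_law :: "real \<Rightarrow> real measure" where
  "uniform_law L = uniform_measure lborel {0<..<L}"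

definition det_law :: "nat \<Rightarrow> nat measure" where
  "det_law n = return (count_space UNIV) n"

text \<open>The law of \<open>1 + M + N\<close> for independent \<open>M\<close> and \<open>N\<close> with laws \<open>\<mu>\<close> and \<open>\<nu>\<close>.\<close>

definition deposit_law :: "nat measure \<Rightarrow> nat measure \<Rightarrow> nat measure" where
  "deposit_law \<mu> \<nu> = distr (\<mu> \<Otimes>\<^sub>M \<nu>) (count_space UNIV) (\<lambda>(m, n). 1 + m + n)"

lemma nat_floor_less:
  fixes c x y :: real
  assumes "c > 0" "c \<le> x" "y \<le> x - c"
  shows "nat \<lfloor>y / c\<rfloor> < nat \<lfloor>x / c\<rfloor>"
proof -
  have "y / c \<le> x / c - 1"
    using assms by (simp add: field_simps)
  then have "\<lfloor>y / c\<rfloor> \<le> \<lfloor>x / c\<rfloor> - 1"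
    by linarith
  moreover have "1 \<le> \<lfloor>x / c\<rfloor>"
    using assms by simp
  ultimately show ?thesis by linarith
qed

text \<open>
  \<open>uda_law a b s\<close> is the law of the total number of particles deposited by the UDA on the strip
  \<open>s\<close>, defined by conditioning on the first deposition. The last alternative of each
  case distinction on \<open>\<tau>\<close> has probability 0, and the value for parameters violating
  \<open>0 \<le> b \<le> a\<close>, \<open>a > 0\<close> is a dummy. The recursion ends because each deposition removes area
  \<open>(a + b) / 2\<close>.
\<close>

context
  notes bind_cong [fundef_cong]
begin

function uda_law :: "real \<Rightarrow> real \<Rightarrow> strip \<Rightarrow> nat measure" where
  "uda_law a b (Para x) =
    (if \<not> (0 \<le> b \<and> b \<le> a \<and> 0 < a) then det_law 0
     else if x < a then det_law 0
     else if x = a then det_law 1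
     else bind (uniform_law (2 * x - 2 * a)) (\<lambda>\<tau>.
       if \<tau> \<in> {0<..<x - a} then
         deposit_law (uda_law a b (Para \<tau>)) (uda_law a b (Trap (x - \<tau> - (a + b) / 2)))
       else if \<tau> \<in> {x - a..<2 * x - 2 * a} then
         (let t = (\<tau> + a - x) + (a - b) / 2
          in deposit_law (uda_law a b (Trap t)) (uda_law a b (Para (x - t - (a + b) / 2))))
       else det_law 0))"
| "uda_law a b (Trap x) =
    (if \<not> (0 \<le> b \<and> b \<le> a \<and> 0 < a) then det_law 0
     else if x < (a + b) / 2 then det_law 0
     else if x = (a + b) / 2 then det_law 1
     else if x < (3 * a - b) / 2 then bind (uniform_law (x - (a + b) / 2)) (\<lambda>\<tau>.
       if \<tau> \<in> {0<..<x - (a + b) / 2} then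
         deposit_law (uda_law a b (Para \<tau>)) (uda_law a b (Para (x - \<tau> - (a + b) / 2)))
       else det_law 0)
     else bind (uniform_law (2 * x - 2 * a)) (\<lambda>\<tau>.
       if \<tau> \<in> {0<..<x - (3 * a - b) / 2} then
         deposit_law (uda_law a b (Trap (\<tau> + (a - b) / 2))) (uda_law a b (Trap (x - \<tau> - a)))
       else if \<tau> \<in> {x - (3 * a - b) / 2..<2 * x - 2 * a} then
         (let y = \<tau> - (x - (3 * a - b) / 2)
          in deposit_law (uda_law a b (Para y)) (uda_law a b (Para (x - y - (a + b) / 2))))
       else det_law 0))"
  by pat_completeness auto
termination
  by (relation "Wellfounded.measure (\<lambda>(a, b, s). nat \<lfloor>area s / ((a + b) / 2)\<rfloor>)";
      (simp only: wf_measure in_measure case_prod_conv area.simps)?;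
      rule nat_floor_less; auto simp: field_simps)

end

text \<open>The expectations of \<open>P\<^sub>x\<close> and \<open>T\<^sub>x\<close>.\<close>

definition mean_P :: "real \<Rightarrow> real \<Rightarrow> real \<Rightarrow> real" where
  "mean_P a b x = (\<integral>n. real n \<partial>uda_law a b (Para x))"

definition mean_T :: "real \<Rightarrow> real \<Rightarrow> real \<Rightarrow> real" where
  "mean_T a b x = (\<integral>n. real n \<partial>uda_law a b (Trap x))"

definition eta :: "real \<Rightarrow> real \<Rightarrow> real \<Rightarrow> real" where
  "eta a b x = (mean_P a b x + mean_T a b x) / 2"

definition lam :: "real \<Rightarrow> real \<Rightarrow> real" where
  "lam a b = Lim at_top (\<lambda>x. eta a b x / x)"

text \<open>The asymptotic coverage density.\<close>

definition xi :: "real \<Rightarrow> real \<Rightarrow> real" where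
  "xi a b = lam a b * (a + b) / 2"

end

theory Submission
  imports Defs "HOL-Real_Asymp.Real_Asymp"
begin

text \<open>
  In this outline \<open>a = 1\<close> and \<open>c = (1 + b) / 2\<close>, which lies in \<open>[1/2, 1]\<close>; \<open>c\<close> is the area of a particle.

  \<^bold>\<open>From the algorithm to a delay equation.\<close> Conditioning on the first deposition gives integral
  equations for the means of \<open>P\<^sub>x\<close> and \<open>T\<^sub>x\<close>. They are interchanged by swapping
  \<open>P\<close> and \<open>T\<close>, so that \<open>\<eta>\<close> satisfies a single equation (\<open>eta_equation\<close>):
  \<open>(x - 1) (\<eta>(x) - 1) = N(x - 1) + N(x - c)\<close> for \<open>x > 1\<close>, where \<open>N(x)\<close> is the integral of \<open>\<eta>\<close>
  over \<open>[0, x]\<close>. Moreover \<open>\<eta> = 0\<close> on \<open>[0, c)\<close> and \<open>\<eta> = 1/2\<close> on \<open>[c, 1)\<close>.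

  \<^bold>\<open>The limit density.\<close> Let \<open>Ein(x)\<close> be the integral of \<open>(1 - exp(-t)) / t\<close> over \<open>[0, x]\<close>.
  The Laplace transform \<open>q(x)\<close> of \<open>s\<^sup>2 exp(s - Ein(s) - Ein(c s))\<close>
  solves the adjoint equation \<open>((x - 1) q(x))' = - q(x + 1) - q(x + c)\<close> and behaves like
  \<open>2 / x\<^sup>3\<close> at infinity. Pairing \<open>q\<close> with \<open>H(x) = N(x) - max 0 (x - c) / 2\<close>, which vanishes
  for \<open>x \<le> 1\<close>, gives a function \<open>Q\<close> whose derivative no longer involves \<open>\<eta>\<close>, so that \<open>Q\<close> converges to an
  explicit integral. On the other hand \<open>Q(x) - 2 H(x) / x\<^sup>2\<close> tends to \<open>0\<close>. Hence
  \<open>\<eta>(x) / x\<close> converges to the same integral (\<open>tendsto_limit_density\<close>), and no Tauberian theorem is needed.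
  The result is, with \<open>w\<^sub>c(u) = exp(- Ein(u) - Ein(c u))\<close> (\<open>xi_eq_coverage\<close>),
  \<open>\<xi>(1, b) = (c / 2) \<integral> w\<^sub>c(u) (1 + exp(-c u) + exp(-(2 c - 1) u)) du\<close>
  over the positive half-line.

  \<^bold>\<open>The shape of the density.\<close> Differentiate with respect to \<open>c\<close> under the integral, and then
  substitute \<open>v = c u\<close>. With \<open>r = 1 / c\<close> this gives \<open>c d\<xi>/dc\<close> as half the integral over \<open>v > 0\<close> of
  \<open>exp(- Ein(v) - Ein(r v)) (exp(-v) (1 + exp(-v) - v) + exp(-(2 - r) v) (exp(-v) - 2 v))\<close>.
  For each \<open>v > 0\<close> this integrand is strictly decreasing in \<open>r\<close> on \<open>[1, 2]\<close>
  (\<open>slope_integrand_strict_decreasing\<close>). So \<open>c d\<xi>/dc\<close> is strictly increasing in \<open>c\<close>. It is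
  negative for \<open>c\<close> near \<open>1/2\<close>, where the integral diverges to \<open>-\<infinity>\<close>, and positive for \<open>c\<close>
  near \<open>1\<close>. Therefore \<open>\<xi>(1, b)\<close> first strictly decreases and then strictly increases.
\<close>

section \<open>The law of the number of particles\<close>

text \<open>The measurable space of probability laws on the natural numbers.\<close>

abbreviation laws :: "nat measure measure" where
  "laws \<equiv> prob_algebra (count_space UNIV)"

lemma det_law_laws [measurable, simp]: "det_law n \<in> space laws"
  by (simp add: det_law_def space_prob_algebra prob_space_return)

lemma measurable_deposit_law [measurable (raw)]:
  assumes [measurable]: "f \<in> M \<rightarrow>\<^sub>M laws" "g \<in> M \<rightarrow>\<^sub>M laws"
  shows "(\<lambda>x. deposit_law (f x) (g x)) \<in> M \<rightarrow>\<^sub>M laws"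
proof -
  have [measurable]: "(\<lambda>(m, n). 1 + m + n) \<in> count_space (UNIV::nat set) \<Otimes>\<^sub>M count_space (UNIV::nat set) \<rightarrow>\<^sub>M count_space (UNIV::nat set)"
    by measurable
  show ?thesis
    unfolding deposit_law_def by measurable
qed

text \<open>
  The uniform law on \<open>(0, L)\<close> as a probability kernel in \<open>L\<close>. The value for \<open>L \<le> 0\<close>
  only serves to make it one.
\<close>

definition uniform_kernel :: "real \<Rightarrow> real measure" where
  "uniform_kernel L = (if 0 < L then uniform_law L else return borel 0)"

lemma prob_space_uniform_law: "0 < L \<Longrightarrow> prob_space (uniform_law L)"
  unfolding uniform_law_def by (rule prob_space_uniform_measure) auto

lemma sets_uniform_law [simp, measurable_cong]: "sets (uniform_law L) = sets borel"
  by (simp add: uniform_law_def)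

lemma space_uniform_law [simp]: "space (uniform_law L) = UNIV"
  by (simp add: uniform_law_def)

lemma measurable_uniform_kernel [measurable]: "uniform_kernel \<in> borel \<rightarrow>\<^sub>M prob_algebra borel"
proof (rule measurable_prob_algebraI)
  show ps: "prob_space (uniform_kernel L)" for L
    by (auto simp: uniform_kernel_def prob_space_uniform_law prob_space_return)
  show "uniform_kernel \<in> borel \<rightarrow>\<^sub>M subprob_algebra borel"
  proof (rule measurable_subprob_algebra)
    show "subprob_space (uniform_kernel L)" for L
      using ps by (rule prob_space_imp_subprob_space)
    show "sets (uniform_kernel L) = sets borel" for L
      by (simp add: uniform_kernel_def)
    fix A :: "real set" assume [measurable]: "A \<in> sets borel"
    have "emeasure (uniform_kernel L) A = (if 0 < L
        then (\<integral>\<^sup>+t. indicator A t * (if 0 < t \<and> t < L then 1 else 0) \<partial>lborel) / ennreal L else indicator A 0)" for L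
    proof (cases "0 < L")
      case True
      have "emeasure lborel ({0<..<L} \<inter> A) = (\<integral>\<^sup>+t. indicator ({0<..<L} \<inter> A) t \<partial>lborel)"
        by (subst nn_integral_indicator) auto
      also have "\<dots> = (\<integral>\<^sup>+t. indicator A t * (if 0 < t \<and> t < L then 1 else 0) \<partial>lborel)"
        by (intro nn_integral_cong) (auto split: split_indicator)
      finally show ?thesis
        using True by (simp add: uniform_kernel_def uniform_law_def emeasure_uniform_measure)
    qed (simp add: uniform_kernel_def)
    then show "(\<lambda>L. emeasure (uniform_kernel L) A) \<in> borel_measurable borel"
      by simp
  qed
qed

lemma nn_integral_uniform_law:
  assumes "0 < L" and [measurable]: "f \<in> borel_measurable borel"
  shows "(\<integral>\<^sup>+t. f t \<partial>uniform_law L) = (\<integral>\<^sup>+t. f t * indicator {0<..<L} t \<partial>lborel) / ennreal L"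
  using assms by (simp add: uniform_law_def nn_integral_uniform_measure)

text \<open>The expectation of a law on the natural numbers, as an extended real.\<close>

definition nn_mean :: "nat measure \<Rightarrow> ennreal" where
  "nn_mean \<mu> = (\<integral>\<^sup>+n. of_nat n \<partial>\<mu>)"

lemma measurable_nn_mean [measurable]: "nn_mean \<in> borel_measurable laws"
proof -
  have "(\<lambda>\<mu>. \<integral>\<^sup>+n. of_nat n \<partial>\<mu>) \<in> borel_measurable (subprob_algebra (count_space UNIV))"
    by measurable
  then show ?thesis
    unfolding nn_mean_def[abs_def] prob_algebra_def by (rule measurable_restrict_space1)
qed

lemma nn_mean_det_law [simp]: "nn_mean (det_law n) = of_nat n"
  by (simp add: nn_mean_def det_law_def nn_integral_return)

lemma nn_mean_deposit_law:
  assumes "\<mu> \<in> space laws" "\<nu> \<in> space laws"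
  shows "nn_mean (deposit_law \<mu> \<nu>) = 1 + nn_mean \<mu> + nn_mean \<nu>"
proof -
  have sets [measurable_cong]: "sets \<mu> = sets (count_space UNIV)" "sets \<nu> = sets (count_space UNIV)"
    and "prob_space \<mu>" "prob_space \<nu>"
    using assms by (auto simp: space_prob_algebra)
  then interpret \<mu>: prob_space \<mu> + \<nu>: prob_space \<nu> 
    by simp_all
  interpret pair_prob_space \<mu> \<nu> ..
  have [measurable]: "(\<lambda>(m, n). 1 + m + n) \<in> \<mu> \<Otimes>\<^sub>M \<nu> \<rightarrow>\<^sub>M count_space (UNIV::nat set)"
    by measurable
  have [measurable]: "(\<lambda>n. of_nat n :: ennreal) \<in> borel_measurable \<mu>" "(\<lambda>n. of_nat n :: ennreal) \<in> borel_measurable \<nu>"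
    by measurable
  have "nn_mean (deposit_law \<mu> \<nu>) = (\<integral>\<^sup>+z. (1 + of_nat (fst z)) + of_nat (snd z) \<partial>(\<mu> \<Otimes>\<^sub>M \<nu>))"
    unfolding nn_mean_def deposit_law_def
    by (subst nn_integral_distr) (auto intro!: nn_integral_cong)
  also have "\<dots> = (\<integral>\<^sup>+m. \<integral>\<^sup>+n. (1 + of_nat m) + of_nat n \<partial>\<nu> \<partial>\<mu>)"
    by (subst \<nu>.nn_integral_fst[symmetric]) auto
  also have "\<dots> = (\<integral>\<^sup>+m. (1 + of_nat m) + nn_mean \<nu> \<partial>\<mu>)"
    by (intro nn_integral_cong, subst nn_integral_add) (auto simp: nn_mean_def \<nu>.emeasure_space_1)
  also have "\<dots> = 1 + nn_mean \<mu> + nn_mean \<nu>"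
    by (simp add: nn_integral_add nn_mean_def \<mu>.emeasure_space_1)
  finally show ?thesis .
qed

lemma bind_uniform_law:
  assumes "0 < L" and f [measurable]: "f \<in> borel \<rightarrow>\<^sub>M laws"
  shows "bind (uniform_law L) f \<in> space laws"
    and "nn_mean (bind (uniform_law L) f) = (\<integral>\<^sup>+t. nn_mean (f t) * indicator {0<..<L} t \<partial>lborel) / ennreal L"
proof -
  have u: "uniform_law L \<in> space (prob_algebra borel)"
    using assms(1) by (simp add: space_prob_algebra prob_space_uniform_law)
  show "bind (uniform_law L) f \<in> space laws"
    using prob_space_bind'[OF u f] sets_bind'[OF u f] by (simp add: space_prob_algebra)
  have "f \<in> uniform_law L \<rightarrow>\<^sub>M laws"
    by measurable
  then have "f \<in> uniform_law L \<rightarrow>\<^sub>M subprob_algebra (count_space UNIV)"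
    by (rule measurable_prob_algebraD)
  then have "nn_mean (bind (uniform_law L) f) = (\<integral>\<^sup>+t. nn_mean (f t) \<partial>uniform_law L)"
    unfolding nn_mean_def by (intro nn_integral_bind) auto
  also have "\<dots> = (\<integral>\<^sup>+t. nn_mean (f t) * indicator {0<..<L} t \<partial>lborel) / ennreal L"
    by (rule nn_integral_uniform_law[OF assms(1)]) measurable
  finally show "nn_mean (bind (uniform_law L) f) = \<dots>" .
qed

text \<open>Each equation contains further instances of its own left-hand side, so rewriting with it does not end.\<close>

declare uda_law.simps [simp del]

lemma uda_law_small:
  assumes "0 \<le> b" "b \<le> a" "0 < a"
  shows "x < a \<Longrightarrow> uda_law a b (Para x) = det_law 0"
    and "uda_law a b (Para a) = det_law 1"
    and "x < (a + b) / 2 \<Longrightarrow> uda_law a b (Trap x) = det_law 0"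
    and "uda_law a b (Trap ((a + b) / 2)) = det_law 1"
  using assms by (subst uda_law.simps; simp)+

text \<open>
  The laws of the numbers of particles after a first deposition, as functions of the variable
  \<open>\<tau>\<close>, for given laws \<open>p\<close> and \<open>t\<close> on the parallelograms and on the trapezia.
\<close>

definition Para_step :: "real \<Rightarrow> real \<Rightarrow> (real \<Rightarrow> nat measure) \<Rightarrow> (real \<Rightarrow> nat measure) \<Rightarrow> real \<Rightarrow> real \<Rightarrow> nat measure"
  where "Para_step a b p t x \<tau> =
    (if 0 < \<tau> \<and> \<tau> < x - a then deposit_law (p \<tau>) (t (x - \<tau> - (a + b) / 2))
     else if x - a \<le> \<tau> \<and> \<tau> < 2 * x - 2 * a then
       deposit_law (t (\<tau> + a - x + (a - b) / 2)) (p (2 * x - 2 * a - \<tau>))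
     else det_law 0)"

definition Trap_step_small :: "real \<Rightarrow> real \<Rightarrow> (real \<Rightarrow> nat measure) \<Rightarrow> real \<Rightarrow> real \<Rightarrow> nat measure"
  where "Trap_step_small a b p x \<tau> =
    (if 0 < \<tau> \<and> \<tau> < x - (a + b) / 2 then deposit_law (p \<tau>) (p (x - \<tau> - (a + b) / 2)) else det_law 0)"

definition Trap_step :: "real \<Rightarrow> real \<Rightarrow> (real \<Rightarrow> nat measure) \<Rightarrow> (real \<Rightarrow> nat measure) \<Rightarrow> real \<Rightarrow> real \<Rightarrow> nat measure"
  where "Trap_step a b p t x \<tau> =
    (if 0 < \<tau> \<and> \<tau> < x - (3 * a - b) / 2 then
       deposit_law (t (\<tau> + (a - b) / 2)) (t (x - \<tau> - a))
     else if x - (3 * a - b) / 2 \<le> \<tau> \<and> \<tau> < 2 * x - 2 * a then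
       deposit_law (p (\<tau> - (x - (3 * a - b) / 2))) (p (2 * x - 2 * a - \<tau>))
     else det_law 0)"

lemma measurable_steps [measurable]:
  assumes [measurable]: "p \<in> borel \<rightarrow>\<^sub>M laws" "t \<in> borel \<rightarrow>\<^sub>M laws"
  shows "(\<lambda>z. Para_step a b p t (fst z) (snd z)) \<in> borel \<Otimes>\<^sub>M borel \<rightarrow>\<^sub>M laws"
    and "(\<lambda>z. Trap_step_small a b p (fst z) (snd z)) \<in> borel \<Otimes>\<^sub>M borel \<rightarrow>\<^sub>M laws"
    and "(\<lambda>z. Trap_step a b p t (fst z) (snd z)) \<in> borel \<Otimes>\<^sub>M borel \<rightarrow>\<^sub>M laws"
  unfolding Para_step_def Trap_step_small_def Trap_step_def by measurable

lemma uda_law_Para: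
  assumes "0 \<le> b" "b \<le> a" "0 < a" "a < x"
  shows "uda_law a b (Para x) = bind (uniform_kernel (2 * x - 2 * a))
    (Para_step a b (\<lambda>y. uda_law a b (Para y)) (\<lambda>y. uda_law a b (Trap y)) x)"
proof -
  have *: "x - (\<tau> + a - x + (a - b) / 2) - (a + b) / 2 = 2 * x - 2 * a - \<tau>" for \<tau>
    by (simp add: field_simps)
  have "uda_law a b (Para x) = bind (uniform_law (2 * x - 2 * a))
    (Para_step a b (\<lambda>y. uda_law a b (Para y)) (\<lambda>y. uda_law a b (Trap y)) x)"
    unfolding Para_step_def[abs_def]
    by (subst uda_law.simps(1))
      (use assms in \<open>simp only: Let_def * greaterThanLessThan_iff atLeastLessThan_iff if_False not_True_eq_False
         conj_absorb simp_thms not_less[symmetric] if_not_P less_imp_neq[symmetric]\<close>)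
  then show ?thesis
    using assms by (simp add: uniform_kernel_def)
qed

lemma uda_law_Trap_small:
  assumes "0 \<le> b" "b \<le> a" "0 < a" "(a + b) / 2 < x" "x < (3 * a - b) / 2"
  shows "uda_law a b (Trap x) = bind (uniform_kernel (x - (a + b) / 2))
    (Trap_step_small a b (\<lambda>y. uda_law a b (Para y)) x)"
proof -
  have "uda_law a b (Trap x) = bind (uniform_law (x - (a + b) / 2))
    (Trap_step_small a b (\<lambda>y. uda_law a b (Para y)) x)"
    unfolding Trap_step_small_def[abs_def]
    by (subst uda_law.simps(2))
      (use assms in \<open>simp only: greaterThanLessThan_iff if_False if_True not_True_eq_False
         simp_thms not_less[symmetric] if_not_P less_imp_neq[symmetric]\<close>)
  then show ?thesis
    using assms by (simp add: uniform_kernel_def)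
qed

lemma uda_law_Trap:
  assumes "0 \<le> b" "b \<le> a" "0 < a" "(a + b) / 2 < x" "(3 * a - b) / 2 \<le> x"
  shows "uda_law a b (Trap x) = bind (uniform_kernel (2 * x - 2 * a))
    (Trap_step a b (\<lambda>y. uda_law a b (Para y)) (\<lambda>y. uda_law a b (Trap y)) x)"
proof -
  have *: "x - (\<tau> - (x - (3 * a - b) / 2)) - (a + b) / 2 = 2 * x - 2 * a - \<tau>" for \<tau>
    by (simp add: field_simps)
  have "a < x"
    using assms by (cases "a = b") auto
  have "uda_law a b (Trap x) = bind (uniform_law (2 * x - 2 * a))
    (Trap_step a b (\<lambda>y. uda_law a b (Para y)) (\<lambda>y. uda_law a b (Trap y)) x)"
    unfolding Trap_step_def[abs_def]
    by (subst uda_law.simps(2))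
      (use assms in \<open>simp only: Let_def * greaterThanLessThan_iff atLeastLessThan_iff if_False not_True_eq_False
         simp_thms not_less[symmetric] if_not_P less_imp_neq[symmetric]\<close>)
  then show ?thesis
    using \<open>a < x\<close> by (simp add: uniform_kernel_def)
qed

lemma bind_step_measurable:
  assumes [measurable]: "u \<in> borel_measurable borel" "(\<lambda>z. f (fst z) (snd z)) \<in> borel \<Otimes>\<^sub>M borel \<rightarrow>\<^sub>M laws"
  shows "(\<lambda>x. bind (uniform_kernel (u x)) (f x)) \<in> borel \<rightarrow>\<^sub>M laws"
  by (rule measurable_bind_prob_space2[where N = borel]) (simp_all add: split_beta')

text \<open>
  The law on a strip depends measurably on its area. The recursion only refers to strips that are
  smaller by at least the area \<open>c\<close> of a particle, so the proof goes up in steps of length \<open>c\<close>.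
\<close>

lemma uda_law_truncated_measurable:
  assumes ab: "0 \<le> b" "b \<le> a" "0 < a"
  defines "c \<equiv> (a + b) / 2"
  shows "(\<lambda>x. if x < real n * c then uda_law a b (Para x) else det_law 0) \<in> borel \<rightarrow>\<^sub>M laws"
    and "(\<lambda>x. if x < real n * c then uda_law a b (Trap x) else det_law 0) \<in> borel \<rightarrow>\<^sub>M laws"
proof (induction n)
  case 0
  have "(\<lambda>x. if x < real 0 * c then uda_law a b (Para x) else det_law 0) = (\<lambda>x. det_law 0)"
    "(\<lambda>x. if x < real 0 * c then uda_law a b (Trap x) else det_law 0) = (\<lambda>x. det_law 0)"
    using ab by (auto simp: fun_eq_iff uda_law_small)
  then show "(\<lambda>x. if x < real 0 * c then uda_law a b (Para x) else det_law 0) \<in> borel \<rightarrow>\<^sub>M laws"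
    and "(\<lambda>x. if x < real 0 * c then uda_law a b (Trap x) else det_law 0) \<in> borel \<rightarrow>\<^sub>M laws"
    by simp_all
next
  case (Suc n)
  define p where "p x = (if x < real n * c then uda_law a b (Para x) else det_law 0)" for x
  define t where "t x = (if x < real n * c then uda_law a b (Trap x) else det_law 0)" for x
  have [measurable]: "p \<in> borel \<rightarrow>\<^sub>M laws" "t \<in> borel \<rightarrow>\<^sub>M laws"
    using Suc by (simp_all add: p_def[abs_def] t_def[abs_def])
  have c: "0 < c" "c \<le> a" "a - c = (a - b) / 2" "(3 * a - b) / 2 = a + (a - b) / 2"
    using ab by (auto simp: c_def field_simps)
  define K where "K = real n * c"
  have n: "real (Suc n) * c = K + c"
    by (simp add: K_def algebra_simps)
  have p: "p y = uda_law a b (Para y)" and t: "t y = uda_law a b (Trap y)" if "y < K" for y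
    using that by (simp_all add: p_def t_def K_def)

  have "Para_step a b (\<lambda>y. uda_law a b (Para y)) (\<lambda>y. uda_law a b (Trap y)) x \<tau> = Para_step a b p t x \<tau>"
    if "x < K + c" "a < x" for x \<tau>
    unfolding Para_step_def c_def[symmetric] using that c(1,2,3)
    by (intro if_cong refl arg_cong2[where f = deposit_law] p[symmetric] t[symmetric]; linarith)
  then have "uda_law a b (Para x) = bind (uniform_kernel (2 * x - 2 * a)) (Para_step a b p t x)"
    if "x < K + c" "a < x" for x
    unfolding uda_law_Para[OF ab that(2)] using that by (intro bind_cong_All) blast
  then have "(if x < K + c then uda_law a b (Para x) else det_law 0) =
      (if x < K + c then if x < a then det_law 0 else if x = a then det_law 1
         else bind (uniform_kernel (2 * x - 2 * a)) (Para_step a b p t x) else det_law 0)" for x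
    using uda_law_small(1)[OF ab, of x] uda_law_small(2)[OF ab] by (intro if_cong refl) (metis linorder_neqE)
  moreover have "(\<lambda>x. bind (uniform_kernel (2 * x - 2 * a)) (Para_step a b p t x)) \<in> borel \<rightarrow>\<^sub>M laws"
    by (rule bind_step_measurable) measurable
  ultimately show "(\<lambda>x. if x < real (Suc n) * c then uda_law a b (Para x) else det_law 0) \<in> borel \<rightarrow>\<^sub>M laws"
    unfolding n by (simp only:) measurable

  have 1: "Trap_step_small a b (\<lambda>y. uda_law a b (Para y)) x \<tau> = Trap_step_small a b p x \<tau>"
    if "x < K + c" "c < x" for x \<tau>
    unfolding Trap_step_small_def c_def[symmetric] using that c(1,2,3)
    by (intro if_cong refl arg_cong2[where f = deposit_law] p[symmetric] t[symmetric]; linarith)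
  have 2: "Trap_step a b (\<lambda>y. uda_law a b (Para y)) (\<lambda>y. uda_law a b (Trap y)) x \<tau> = Trap_step a b p t x \<tau>"
    if "x < K + c" "c < x" for x \<tau>
    unfolding Trap_step_def c_def[symmetric] c(4) using that c(1,2,3)
    by (intro if_cong refl arg_cong2[where f = deposit_law] p[symmetric] t[symmetric]; linarith)
  have "uda_law a b (Trap x) = (if x < (3 * a - b) / 2
      then bind (uniform_kernel (x - c)) (Trap_step_small a b p x)
      else bind (uniform_kernel (2 * x - 2 * a)) (Trap_step a b p t x))" if "x < K + c" "c < x" for x
  proof (cases "x < (3 * a - b) / 2")
    case True
    have "uda_law a b (Trap x) = bind (uniform_kernel (x - c)) (Trap_step_small a b p x)"
      unfolding uda_law_Trap_small[OF ab that(2)[unfolded c_def] True] c_def[symmetric]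
      using 1[OF that] by (intro bind_cong_All) blast
    then show ?thesis
      using True by simp
  next
    case False
    have "uda_law a b (Trap x) = bind (uniform_kernel (2 * x - 2 * a)) (Trap_step a b p t x)"
      unfolding uda_law_Trap[OF ab that(2)[unfolded c_def] False[unfolded not_less]]
      using 2[OF that] by (intro bind_cong_All) blast
    then show ?thesis
      using False by simp
  qed
  then have "(if x < K + c then uda_law a b (Trap x) else det_law 0) =
      (if x < K + c then if x < c then det_law 0 else if x = c then det_law 1
         else if x < (3 * a - b) / 2 then bind (uniform_kernel (x - c)) (Trap_step_small a b p x)
         else bind (uniform_kernel (2 * x - 2 * a)) (Trap_step a b p t x) else det_law 0)" for x
    using uda_law_small(3)[OF ab, of x] uda_law_small(4)[OF ab] unfolding c_def[symmetric]
    by (intro if_cong refl) (metis linorder_neqE)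
  moreover have "(\<lambda>x. bind (uniform_kernel (x - c)) (Trap_step_small a b p x)) \<in> borel \<rightarrow>\<^sub>M laws"
    "(\<lambda>x. bind (uniform_kernel (2 * x - 2 * a)) (Trap_step a b p t x)) \<in> borel \<rightarrow>\<^sub>M laws"
    by (rule bind_step_measurable, measurable)+
  ultimately show "(\<lambda>x. if x < real (Suc n) * c then uda_law a b (Trap x) else det_law 0) \<in> borel \<rightarrow>\<^sub>M laws"
    unfolding n by (simp only:) measurable
qed

lemma measurable_uda_law:
  assumes ab: "0 \<le> b" "b \<le> a" "0 < a"
  shows "(\<lambda>x. uda_law a b (Para x)) \<in> borel \<rightarrow>\<^sub>M laws" and "(\<lambda>x. uda_law a b (Trap x)) \<in> borel \<rightarrow>\<^sub>M laws"
proof -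
  define c where "c = (a + b) / 2"
  have "0 < c" using ab by (simp add: c_def)
  have lt: "x < real (nat \<lceil>x / c\<rceil> + 1) * c" for x
  proof -
    have "x / c < real (nat \<lceil>x / c\<rceil> + 1)"
      by linarith
    then show ?thesis
      using \<open>0 < c\<close> by (simp add: field_simps)
  qed
  have [measurable]: "(\<lambda>x::real. nat \<lceil>x / c\<rceil> + 1) \<in> borel \<rightarrow>\<^sub>M count_space UNIV"
    by measurable
  have "(\<lambda>x. (if x < real (nat \<lceil>x / c\<rceil> + 1) * c then uda_law a b (Para x) else det_law 0)) \<in> borel \<rightarrow>\<^sub>M laws"
    using uda_law_truncated_measurable(1)[OF ab, folded c_def]
    by (rule measurable_compose_countable[where g = "\<lambda>x. nat \<lceil>x / c\<rceil> + 1"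
      and f = "\<lambda>i x. if x < real i * c then uda_law a b (Para x) else det_law 0"]) measurable
  then show "(\<lambda>x. uda_law a b (Para x)) \<in> borel \<rightarrow>\<^sub>M laws"
    using lt by simp
  have "(\<lambda>x. (if x < real (nat \<lceil>x / c\<rceil> + 1) * c then uda_law a b (Trap x) else det_law 0)) \<in> borel \<rightarrow>\<^sub>M laws"
    using uda_law_truncated_measurable(2)[OF ab, folded c_def]
    by (rule measurable_compose_countable[where g = "\<lambda>x. nat \<lceil>x / c\<rceil> + 1"
      and f = "\<lambda>i x. if x < real i * c then uda_law a b (Trap x) else det_law 0"]) measurable
  then show "(\<lambda>x. uda_law a b (Trap x)) \<in> borel \<rightarrow>\<^sub>M laws"
    using lt by simp
qed

section \<open>Integral equations for the expected numbers\<close>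

text \<open>A bound for the means of all continuations is a bound for the mean of the mixture.\<close>

lemma nn_mean_bind_le:
  assumes "0 < L" and [measurable]: "K \<in> borel \<rightarrow>\<^sub>M laws"
    and "\<And>\<tau>. 0 < \<tau> \<Longrightarrow> \<tau> < L \<Longrightarrow> nn_mean (K \<tau>) \<le> ennreal B"
  shows "nn_mean (bind (uniform_kernel L) K) \<le> ennreal B"
proof -
  have "nn_mean (bind (uniform_kernel L) K) = (\<integral>\<^sup>+t. nn_mean (K t) * indicator {0<..<L} t \<partial>lborel) / ennreal L"
    using assms(1) by (simp add: uniform_kernel_def bind_uniform_law)
  also have "\<dots> \<le> (\<integral>\<^sup>+t. ennreal B * indicator {0<..<L} t \<partial>lborel) / ennreal L"
    using assms(3) by (intro divide_right_mono_ennreal nn_integral_mono) (auto split: split_indicator)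
  also have "\<dots> = ennreal B * ennreal L / ennreal L"
    using assms(1) by (simp add: nn_integral_cmult_indicator)
  also have "\<dots> = ennreal B"
    using assms(1) by (simp add: ennreal_mult_divide_eq)
  finally show ?thesis .
qed

text \<open>
  The mean of the mixture is the average of the means of the continuations, as a Henstock-Kurzweil
  integral.
\<close>

lemma nn_mean_bind_eq:
  assumes "0 < L" and [measurable]: "K \<in> borel \<rightarrow>\<^sub>M laws" "F \<in> borel_measurable borel"
    and eq: "\<And>\<tau>. 0 < \<tau> \<Longrightarrow> \<tau> < L \<Longrightarrow> nn_mean (K \<tau>) = ennreal (F \<tau>)"
    and F: "\<And>\<tau>. 0 < \<tau> \<Longrightarrow> \<tau> < L \<Longrightarrow> 0 \<le> F \<tau>" "\<And>\<tau>. 0 < \<tau> \<Longrightarrow> \<tau> < L \<Longrightarrow> F \<tau> \<le> B"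
  shows "nn_mean (bind (uniform_kernel L) K) = ennreal (integral {0..L} F / L)"
proof -
  have int: "set_integrable lborel {0<..<L} F"
    unfolding set_integrable_def
    by (rule integrableI_bounded_set_indicator[where B = B]) (use assms(1) F in auto)
  have "integral {0<..<L} F = (LINT x:{0<..<L}|lborel. F x)"
    using set_borel_integral_eq_integral(2)[OF int] by simp
  moreover have "integral {0<..<L} F = integral {0..L} F"
    by (simp add: integral_open_interval_real)
  moreover have "(\<integral>\<^sup>+t. nn_mean (K t) * indicator {0<..<L} t \<partial>lborel) = (\<integral>\<^sup>+t. ennreal (indicator {0<..<L} t *\<^sub>R F t) \<partial>lborel)"
    using eq by (intro nn_integral_cong) (auto split: split_indicator)
  moreover have "\<dots> = ennreal (LINT x:{0<..<L}|lborel. F x)"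
    unfolding set_lebesgue_integral_def
    by (rule nn_integral_eq_integral) (use int F in \<open>auto simp: set_integrable_def split: split_indicator\<close>)
  moreover have "0 \<le> (LINT x:{0<..<L}|lborel. F x)"
    unfolding set_lebesgue_integral_def using F
    by (intro Bochner_Integration.integral_nonneg) (auto split: split_indicator)
  ultimately show ?thesis
    using assms(1) by (simp add: uniform_kernel_def bind_uniform_law divide_ennreal)
qed

lemma space_lawsD [simp]: "f \<in> borel \<rightarrow>\<^sub>M laws \<Longrightarrow> f (x::real) \<in> space laws"
  by (simp add: measurable_space[where M = borel])

lemma integral_reflect_about:
  fixes f :: "real \<Rightarrow> real"
  shows "integral {u..v} (\<lambda>\<tau>. f (k - \<tau>)) = integral {k - v..k - u} f"
proof -
  have "integral {u..v} (\<lambda>\<tau>. f (k - \<tau>)) = integral {- v..- u} (\<lambda>\<tau>. f (\<tau> + k))"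
    using Henstock_Kurzweil_Integration.integral_reflect_real[of "- u" "- v" "\<lambda>\<tau>. f (\<tau> + k)", symmetric] by (simp add: algebra_simps)
  also have "\<dots> = integral {k - v..k - u} f"
    using integral_shift_real_ivl[of "k - v" k "k - u" f] by simp
  finally show ?thesis .
qed

lemma integral_shift_by:
  fixes f :: "real \<Rightarrow> real"
  shows "integral {u..v} (\<lambda>\<tau>. f (\<tau> + k)) = integral {u + k..v + k} f"
  using integral_shift_real_ivl[of "u + k" k "v + k" f] by simp

lemma integral_shift_by_minus:
  fixes f :: "real \<Rightarrow> real"
  shows "integral {u..v} (\<lambda>\<tau>. f (\<tau> - k)) = integral {u - k..v - k} f"
  using integral_shift_by[of u v f "- k"] by simp

lemma integral_if_less:
  fixes f g :: "real \<Rightarrow> real"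
  assumes "u \<le> s" "s \<le> v" "f integrable_on {u..s}" "g integrable_on {s..v}"
  shows "integral {u..v} (\<lambda>\<tau>. if \<tau> < s then f \<tau> else g \<tau>) = integral {u..s} f + integral {s..v} g"
proof -
  have "((\<lambda>\<tau>. if \<tau> < s then f \<tau> else g \<tau>) has_integral integral {u..s} f) {u..s}"
    by (rule has_integral_spike[OF negligible_sing[of s] _ integrable_integral[OF assms(3)]]) auto
  moreover have "((\<lambda>\<tau>. if \<tau> < s then f \<tau> else g \<tau>) has_integral integral {s..v} g) {s..v}"
    by (rule has_integral_spike[OF negligible_sing[of s] _ integrable_integral[OF assms(4)]]) auto
  ultimately show ?thesis
    using assms(1,2) by (intro integral_unique has_integral_combine)
qed

context
  fixes a b c :: real
  assumes ab: "0 \<le> b" "b \<le> a" "0 < a"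
  defines "c \<equiv> (a + b) / 2"
begin

lemma uda_law_laws [measurable, simp]:
  "(\<lambda>x. uda_law a b (Para x)) \<in> borel \<rightarrow>\<^sub>M laws" "(\<lambda>x. uda_law a b (Trap x)) \<in> borel \<rightarrow>\<^sub>M laws"
  using measurable_uda_law[OF ab] by auto

lemma uda_law_laws' [simp]: "uda_law a b s \<in> space laws"
  using space_lawsD[OF uda_law_laws(1)] space_lawsD[OF uda_law_laws(2)] by (cases s) auto

lemma steps_measurable [measurable]:
  "Para_step a b (\<lambda>y. uda_law a b (Para y)) (\<lambda>y. uda_law a b (Trap y)) x \<in> borel \<rightarrow>\<^sub>M laws"
  "Trap_step_small a b (\<lambda>y. uda_law a b (Para y)) x \<in> borel \<rightarrow>\<^sub>M laws"
  "Trap_step a b (\<lambda>y. uda_law a b (Para y)) (\<lambda>y. uda_law a b (Trap y)) x \<in> borel \<rightarrow>\<^sub>M laws"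
  unfolding Para_step_def[abs_def] Trap_step_def[abs_def] Trap_step_small_def[abs_def] by measurable

lemma c_facts: "0 < c" "c \<le> a" "(a - b) / 2 = a - c" "(3 * a - b) / 2 = a + (a - c)" "a - c \<le> c"
  using ab by (auto simp: c_def field_simps)

text \<open>Particles cannot overlap, so their number is at most the area of the strip over the area of
  a particle.\<close>

lemma nn_mean_uda_law_le: "nn_mean (uda_law a b s) \<le> ennreal (area s / c)"
proof -
  have dep: "nn_mean (deposit_law (uda_law a b s1) (uda_law a b s2)) \<le> ennreal (area s / c)"
    if "area s = area s1 + area s2 + c" "0 \<le> area s1" "0 \<le> area s2"
      "nn_mean (uda_law a b s1) \<le> ennreal (area s1 / c)" "nn_mean (uda_law a b s2) \<le> ennreal (area s2 / c)"
    for s s1 s2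
  proof -
    have "nn_mean (deposit_law (uda_law a b s1) (uda_law a b s2)) \<le> ennreal 1 + ennreal (area s1 / c) + ennreal (area s2 / c)"
      using that by (simp add: nn_mean_deposit_law add_mono)
    also have "\<dots> = ennreal (1 + area s1 / c + area s2 / c)"
      using that c_facts(1) by (simp add: ennreal_plus[symmetric] del: ennreal_plus ennreal_1)
    also have "1 + area s1 / c + area s2 / c = area s / c"
      using that(1) c_facts(1) by (simp add: field_simps)
    finally show ?thesis .
  qed
  have "\<forall>s. area s < real n * c \<longrightarrow> nn_mean (uda_law a b s) \<le> ennreal (area s / c)" for n
  proof (induction n)
    case 0
    have "uda_law a b (Para x) = det_law 0" "uda_law a b (Trap x) = det_law 0" if "x < 0" for x
      using that ab by (auto intro: uda_law_small)
    then have "nn_mean (uda_law a b s) = 0" if "area s < 0" for s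
      using that by (cases s) auto
    then show ?case
      by simp
  next
    case (Suc n)
    define K where "K = real n * c"
    have K: "real (Suc n) * c = K + c"
      by (simp add: K_def algebra_simps)
    note IH = Suc[folded K_def, rule_format]
    have para: "nn_mean (uda_law a b (Para x)) \<le> ennreal (x / c)" if x: "x < K + c" for x
    proof -
      consider "x < a" | "x = a" | "a < x" by linarith
      then show ?thesis
      proof cases
        case 1
        then show ?thesis by (simp add: uda_law_small[OF ab])
      next
        case 2
        have "ennreal 1 \<le> ennreal (a / c)"
          using c_facts by (intro ennreal_leI) (simp add: field_simps)
        then show ?thesis using 2 by (simp add: uda_law_small[OF ab])
      next
        case 3
        have "nn_mean (Para_step a b (\<lambda>y. uda_law a b (Para y)) (\<lambda>y. uda_law a b (Trap y)) x \<tau>) \<le> ennreal (x / c)"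
          if \<tau>: "0 < \<tau>" "\<tau> < 2 * x - 2 * a" for \<tau>
          unfolding Para_step_def c_def[symmetric] c_facts(3)
          using \<tau> x c_facts 3
          by (auto intro!: dep[of "Para x", simplified] IH[of "Para _", simplified] IH[of "Trap _", simplified])
        then show ?thesis
          unfolding uda_law_Para[OF ab 3] using 3 by (intro nn_mean_bind_le) auto
      qed
    qed
    have trap: "nn_mean (uda_law a b (Trap x)) \<le> ennreal (x / c)" if x: "x < K + c" for x
    proof -
      consider "x < c" | "x = c" | "c < x" "x < (3 * a - b) / 2" | "c < x" "(3 * a - b) / 2 \<le> x" by linarith
      then show ?thesis
      proof cases
        case 1
        then show ?thesis by (simp add: uda_law_small[OF ab] c_def)
      next
        case 2
        have "nn_mean (uda_law a b (Trap c)) = 1"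
          using uda_law_small(4)[OF ab] by (simp add: c_def)
        then show ?thesis using 2 c_facts(1) by simp
      next
        case 3
        have "nn_mean (Trap_step_small a b (\<lambda>y. uda_law a b (Para y)) x \<tau>) \<le> ennreal (x / c)"
          if \<tau>: "0 < \<tau>" "\<tau> < x - c" for \<tau>
          unfolding Trap_step_small_def c_def[symmetric]
          using \<tau> x c_facts 3
          by (auto intro!: dep[of "Trap x", simplified] IH[of "Para _", simplified] IH[of "Trap _", simplified])
        then show ?thesis
          unfolding uda_law_Trap_small[OF ab 3[unfolded c_def]] using 3
          by (intro nn_mean_bind_le) (auto simp: c_def)
      next
        case 4
        have "a < x"
          using 4 c_facts by linarith
        have "nn_mean (Trap_step a b (\<lambda>y. uda_law a b (Para y)) (\<lambda>y. uda_law a b (Trap y)) x \<tau>) \<le> ennreal (x / c)"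
          if \<tau>: "0 < \<tau>" "\<tau> < 2 * x - 2 * a" for \<tau>
          unfolding Trap_step_def c_def[symmetric] c_facts(3,4)
          using \<tau> x c_facts 4 \<open>a < x\<close>
          by (auto intro!: dep[of "Trap x", simplified] IH[of "Para _", simplified] IH[of "Trap _", simplified])
        then show ?thesis
          unfolding uda_law_Trap[OF ab 4[unfolded c_def]] using \<open>a < x\<close>
          by (intro nn_mean_bind_le) auto
      qed
    qed
    show ?case
      unfolding K using para trap by (metis area.elims)
  qed
  moreover obtain n where "area s < real n * c"
    using reals_Archimedean3[OF c_facts(1)] by blast
  ultimately show ?thesis by blast
qed

lemma integral_real_of_nat_law:
  assumes "sets \<mu> = sets (count_space UNIV)"
  shows "(\<integral>n. real n \<partial>\<mu>) = enn2real (nn_mean \<mu>)"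
proof -
  have [measurable]: "real \<in> borel_measurable \<mu>"
    unfolding measurable_cong_sets[OF assms refl] by simp
  show ?thesis
    by (subst integral_eq_nn_integral) (simp_all add: nn_mean_def ennreal_of_nat_eq_real_of_nat)
qed

lemma uda_law_sets: "sets (uda_law a b s) = sets (count_space UNIV)"
  using uda_law_laws'[of s] by (simp add: space_prob_algebra)

lemma mean_eq:
  "mean_P a b x = enn2real (nn_mean (uda_law a b (Para x)))"
  "mean_T a b x = enn2real (nn_mean (uda_law a b (Trap x)))"
  by (simp_all add: mean_P_def mean_T_def integral_real_of_nat_law uda_law_sets)

lemma nn_mean_eq:
  "nn_mean (uda_law a b (Para x)) = ennreal (mean_P a b x)"
  "nn_mean (uda_law a b (Trap x)) = ennreal (mean_T a b x)"
  using le_less_trans[OF nn_mean_uda_law_le[of "Para x"] ennreal_less_top]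
    le_less_trans[OF nn_mean_uda_law_le[of "Trap x"] ennreal_less_top]
  by (simp_all add: mean_eq)

lemma mean_nonneg: "0 \<le> mean_P a b x" "0 \<le> mean_T a b x"
  by (simp_all add: mean_eq)

lemma mean_le:
  assumes "0 \<le> x" shows "mean_P a b x \<le> x / c" "mean_T a b x \<le> x / c"
  using nn_mean_uda_law_le[of "Para x"] nn_mean_uda_law_le[of "Trap x"] assms c_facts(1)
  by (auto simp: nn_mean_eq c_def[symmetric])

lemma measurable_mean [measurable]: "mean_P a b \<in> borel_measurable borel" "mean_T a b \<in> borel_measurable borel"
proof -
  have [measurable]: "(\<lambda>x. nn_mean (uda_law a b (Para x))) \<in> borel_measurable borel"
      "(\<lambda>x. nn_mean (uda_law a b (Trap x))) \<in> borel_measurable borel"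
    using uda_law_laws measurable_nn_mean by (auto intro: measurable_compose)
  show "mean_P a b \<in> borel_measurable borel" "mean_T a b \<in> borel_measurable borel"
    unfolding mean_eq[abs_def] by measurable
qed

lemma mean_small:
  "x < a \<Longrightarrow> mean_P a b x = 0" "x < c \<Longrightarrow> mean_T a b x = 0" "mean_T a b c = 1"
  using uda_law_small[OF ab] by (auto simp: mean_eq c_def)

lemma mean_integrable:
  "mean_P a b integrable_on {u..v}" "mean_T a b integrable_on {u..v}"
proof -
  have "f integrable_on {u..v}"
    if [measurable]: "f \<in> borel_measurable borel" and f: "\<And>x. 0 \<le> f x" "\<And>x. 0 \<le> x \<Longrightarrow> f x \<le> x / c" "\<And>x. x < 0 \<Longrightarrow> f x = 0"
    for f :: "real \<Rightarrow> real"
  proof -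
    have "norm (f x) \<le> \<bar>v\<bar> / c" if "x \<in> {u..v}" for x
    proof (cases "x < 0")
      case False
      then have "f x \<le> x / c" "x / c \<le> \<bar>v\<bar> / c"
        using f c_facts(1) that by (auto intro!: divide_right_mono)
      then show ?thesis using f(1)[of x] by simp
    qed (use f(3) c_facts(1) in auto)
    then have "set_integrable lborel {u..v} f"
      unfolding set_integrable_def
      by (intro integrableI_bounded_set_indicator[where B = "\<bar>v\<bar> / c"])
        (auto simp: emeasure_lborel_Icc_eq)
    then show ?thesis
      by (rule set_borel_integral_eq_integral)
  qed
  from this[of "mean_P a b"] this[of "mean_T a b"]
  show "mean_P a b integrable_on {u..v}" "mean_T a b integrable_on {u..v}"
    using mean_nonneg mean_le mean_small ab c_facts(1) by simp_all
qed

lemma mean_integrable_reflect: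
  "(\<lambda>\<tau>. mean_P a b (k - \<tau>)) integrable_on {u..v}" "(\<lambda>\<tau>. mean_T a b (k - \<tau>)) integrable_on {u..v}"
  "(\<lambda>\<tau>. mean_P a b (\<tau> + k)) integrable_on {u..v}" "(\<lambda>\<tau>. mean_T a b (\<tau> + k)) integrable_on {u..v}"
proof -
  have shift: "(\<lambda>\<tau>. f (\<tau> + k)) integrable_on {u..v}" if "\<And>u v. f integrable_on {u..v}" for f :: "real \<Rightarrow> real" and u v
    using integrable_on_shift_cbox[of f k u v] that[of "u + k" "v + k"] by (simp add: comp_def add.commute)
  have "(\<lambda>\<tau>. f (k - \<tau>)) integrable_on {u..v}" if "\<And>u v. f integrable_on {u..v}" for f :: "real \<Rightarrow> real"
    using Henstock_Kurzweil_Integration.integrable_reflect_real[of "\<lambda>\<tau>. f (\<tau> + k)" "- u" "- v"] shift[OF that, of "-v" "-u"] by (simp add: algebra_simps)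
  then show "(\<lambda>\<tau>. mean_P a b (k - \<tau>)) integrable_on {u..v}" "(\<lambda>\<tau>. mean_T a b (k - \<tau>)) integrable_on {u..v}"
    "(\<lambda>\<tau>. mean_P a b (\<tau> + k)) integrable_on {u..v}" "(\<lambda>\<tau>. mean_T a b (\<tau> + k)) integrable_on {u..v}"
    using shift mean_integrable by simp_all
qed

lemma nn_mean_deposit_uda:
  "nn_mean (deposit_law (uda_law a b s1) (uda_law a b s2))
    = 1 + nn_mean (uda_law a b s1) + nn_mean (uda_law a b s2)"
  using uda_law_laws' by (simp add: nn_mean_deposit_law)

lemma ennreal_one_plus: "0 \<le> u \<Longrightarrow> 0 \<le> v \<Longrightarrow> 1 + ennreal u + ennreal v = ennreal (1 + u + v)"
  by (simp add: ennreal_plus[symmetric] ennreal_1[symmetric] del: ennreal_plus ennreal_1)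

text \<open>Nothing fits on a trapezium of area below \<open>a - c \<le> c\<close>.\<close>

lemma mean_T_integral_from_0:
  assumes "0 \<le> v" shows "integral {a - c..v + (a - c)} (mean_T a b) = integral {0..v + (a - c)} (mean_T a b)"
proof -
  have "integral {0..a - c} (mean_T a b) = integral {0..a - c} (\<lambda>_. 0)"
    using c_facts by (intro Henstock_Kurzweil_Integration.integral_spike[OF negligible_sing[of "c"]]) (auto simp: mean_small)
  moreover have "integral {0..a - c} (mean_T a b) + integral {a - c..v + (a - c)} (mean_T a b) = integral {0..v + (a - c)} (mean_T a b)"
    using assms c_facts by (intro Henstock_Kurzweil_Integration.integral_combine mean_integrable) auto
  ultimately show ?thesis by simp
qed

lemma mean_P_equation:
  assumes x: "a < x"
  shows "(x - a) * (mean_P a b x - 1) = integral {0..x - a} (mean_P a b) + integral {0..x - c} (mean_T a b)"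
proof -
  let ?p = "mean_P a b" and ?t = "mean_T a b"
  define F where "F \<tau> = (if \<tau> < x - a then 1 + ?p \<tau> + ?t ((x - c) - \<tau>)
    else 1 + ?t (\<tau> + (a - x + (a - c))) + ?p ((2 * x - 2 * a) - \<tau>))" for \<tau>
  have [measurable]: "F \<in> borel_measurable borel"
    unfolding F_def[abs_def] by measurable
  have nn: "nn_mean (Para_step a b (\<lambda>y. uda_law a b (Para y)) (\<lambda>y. uda_law a b (Trap y)) x \<tau>) = ennreal (F \<tau>)"
    if "0 < \<tau>" "\<tau> < 2 * x - 2 * a" for \<tau>
  proof -
    have e: "x - \<tau> - c = x - c - \<tau>" "\<tau> + a - x + (a - c) = \<tau> + (a - x + (a - c))"
      by simp_all
    show ?thesis
      unfolding Para_step_def c_def[symmetric] c_facts(3) F_def e using that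
      by (simp add: nn_mean_deposit_uda nn_mean_eq ennreal_one_plus mean_nonneg del: ennreal_plus)
  qed
  have F0: "0 \<le> F \<tau>" for \<tau>
    using mean_nonneg by (auto simp: F_def)
  have FB: "F \<tau> \<le> x / c" if "0 < \<tau>" "\<tau> < 2 * x - 2 * a" for \<tau>
  proof (cases "\<tau> < x - a")
    case True
    then have "F \<tau> \<le> 1 + \<tau> / c + ((x - c) - \<tau>) / c"
      using that mean_le c_facts(1,2) by (auto simp: F_def intro!: add_mono)
    also have "\<dots> = x / c"
      using c_facts(1) by (simp add: field_simps)
    finally show ?thesis .
  next
    case False
    then have "F \<tau> \<le> 1 + (\<tau> + (a - x + (a - c))) / c + ((2 * x - 2 * a) - \<tau>) / c"
      using that mean_le c_facts(1,2) by (auto simp: F_def intro!: add_mono)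
    also have "\<dots> = x / c"
      using c_facts(1) by (simp add: field_simps)
    finally show ?thesis .
  qed
  have "ennreal (?p x) = ennreal (integral {0..2 * x - 2 * a} F / (2 * x - 2 * a))"
    unfolding nn_mean_eq[symmetric] uda_law_Para[OF ab x]
    by (rule nn_mean_bind_eq[where B = "x / c"]) (use x nn F0 FB steps_measurable in auto)
  moreover have "0 \<le> integral {0..2 * x - 2 * a} F"
    by (cases "F integrable_on {0..2 * x - 2 * a}") (auto simp: F0 not_integrable_integral intro: integral_nonneg)
  ultimately have "?p x = integral {0..2 * x - 2 * a} F / (2 * x - 2 * a)"
    using mean_nonneg(1)[of x] x by (subst (asm) ennreal_inj) auto
  moreover have "integral {0..2 * x - 2 * a} F =
      integral {0..x - a} (\<lambda>\<tau>. 1 + ?p \<tau> + ?t ((x - c) - \<tau>)) +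
      integral {x - a..2 * x - 2 * a} (\<lambda>\<tau>. 1 + ?t (\<tau> + (a - x + (a - c))) + ?p ((2 * x - 2 * a) - \<tau>))"
    unfolding F_def using x by (intro integral_if_less integrable_add integrable_const_ivl mean_integrable mean_integrable_reflect) auto
  moreover have "integral {0..x - a} (\<lambda>\<tau>. 1 + ?p \<tau> + ?t ((x - c) - \<tau>)) =
      (x - a) + integral {0..x - a} ?p + integral {a - c..x - c} ?t"
    using x by (simp add: Henstock_Kurzweil_Integration.integral_add integrable_add integrable_const_ivl mean_integrable mean_integrable_reflect
        integral_reflect_about)
  moreover have "integral {x - a..2 * x - 2 * a} (\<lambda>\<tau>. 1 + ?t (\<tau> + (a - x + (a - c))) + ?p ((2 * x - 2 * a) - \<tau>)) =
      (x - a) + integral {a - c..x - c} ?t + integral {0..x - a} ?p"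
    using x
    by (simp add: Henstock_Kurzweil_Integration.integral_add integrable_add integrable_const_ivl mean_integrable mean_integrable_reflect
        integral_reflect_about integral_shift_by)
  moreover have "integral {a - c..x - c} ?t = integral {0..x - c} ?t"
    using mean_T_integral_from_0[of "x - a"] x by simp
  ultimately show ?thesis
    using x by (simp add: field_simps)
qed

text \<open>On a trapezium of this size, the two parallelograms left by a deposition are too small for another one.\<close>

lemma mean_T_small:
  assumes x: "c \<le> x" "x < a + (a - c)"
  shows "mean_T a b x = 1"
proof (cases "x = c")
  case False
  with x have x': "c < x" by simp
  have "nn_mean (Trap_step_small a b (\<lambda>y. uda_law a b (Para y)) x \<tau>) = ennreal 1"
    if "0 < \<tau>" "\<tau> < x - c" for \<tau>
  proof -
    have "x - c < a"
      using x ab by (simp add: c_def field_simps)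
    then show ?thesis
      unfolding Trap_step_small_def c_def[symmetric] using that
      by (simp add: nn_mean_deposit_uda nn_mean_eq mean_small)
  qed
  then have "ennreal (mean_T a b x) = ennreal (integral {0..x - c} (\<lambda>_. 1) / (x - c))"
    unfolding nn_mean_eq[symmetric] uda_law_Trap_small[OF ab x'[unfolded c_def] x(2)[folded c_facts(4)]] c_def[symmetric]
    by (intro nn_mean_bind_eq[where B = 1]) (use x' steps_measurable in auto)
  then show ?thesis
    using x' by simp
qed (simp add: mean_small)

text \<open>
  For \<open>x < a + (a - c)\<close> the algorithm uses a different rule, but both sides of the equation vanish.
\<close>

lemma mean_T_equation:
  assumes x: "a < x"
  shows "(x - a) * (mean_T a b x - 1) = integral {0..x - a} (mean_T a b) + integral {0..x - c} (mean_P a b)"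
proof (cases "x < a + (a - c)")
  case True
  have "integral {0..x - a} (mean_T a b) = integral {0..x - a} (\<lambda>_. 0)"
    using c_facts True by (intro Henstock_Kurzweil_Integration.integral_cong) (auto simp: mean_small)
  moreover have "integral {0..x - c} (mean_P a b) = integral {0..x - c} (\<lambda>_. 0)"
    using ab True by (intro Henstock_Kurzweil_Integration.integral_cong mean_small) (auto simp: c_def field_simps)
  ultimately show ?thesis
    using mean_T_small[of x] True x c_facts by simp
next
  case False
  let ?p = "mean_P a b" and ?t = "mean_T a b"
  define s where "s = x - (a + (a - c))"
  have s: "0 \<le> s" "s < 2 * x - 2 * a" "2 * x - 2 * a = s + (x - c)" "s + (a - c) = x - a" "x - a - s = a - c"
    using False x c_facts by (auto simp: s_def)
  define F where "F \<tau> = (if \<tau> < s then 1 + ?t (\<tau> + (a - c)) + ?t ((x - a) - \<tau>)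
    else 1 + ?p (\<tau> + (- s)) + ?p ((2 * x - 2 * a) - \<tau>))" for \<tau>
  have [measurable]: "F \<in> borel_measurable borel"
    unfolding F_def[abs_def] by measurable
  have nn: "nn_mean (Trap_step a b (\<lambda>y. uda_law a b (Para y)) (\<lambda>y. uda_law a b (Trap y)) x \<tau>) = ennreal (F \<tau>)"
    if "0 < \<tau>" "\<tau> < 2 * x - 2 * a" for \<tau>
  proof -
    have e: "x - \<tau> - a = x - a - \<tau>" "\<tau> - s = \<tau> + (- s)"
      by simp_all
    show ?thesis
      unfolding Trap_step_def c_def[symmetric] c_facts(3,4) F_def s_def[symmetric] e using that
      by (simp add: nn_mean_deposit_uda nn_mean_eq ennreal_one_plus mean_nonneg del: ennreal_plus)
  qed
  have F0: "0 \<le> F \<tau>" for \<tau>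
    using mean_nonneg by (auto simp: F_def)
  have FB: "F \<tau> \<le> x / c" if "0 < \<tau>" "\<tau> < 2 * x - 2 * a" for \<tau>
  proof (cases "\<tau> < s")
    case True
    then have "F \<tau> \<le> 1 + (\<tau> + (a - c)) / c + ((x - a) - \<tau>) / c"
      using that mean_le s c_facts(1,2) by (auto simp: F_def intro!: add_mono)
    also have "\<dots> = x / c"
      using c_facts(1) by (simp add: field_simps)
    finally show ?thesis .
  next
    case False
    then have "F \<tau> \<le> 1 + (\<tau> + (- s)) / c + ((2 * x - 2 * a) - \<tau>) / c"
      using that mean_le c_facts(1,2) by (auto simp: F_def intro!: add_mono)
    also have "\<dots> = x / c"
      using c_facts(1) by (simp add: s_def field_simps)
    finally show ?thesis .
  qed
  have x': "(a + b) / 2 < x" "(3 * a - b) / 2 \<le> x"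
    using False x c_facts by (auto simp: c_def[symmetric])
  have "ennreal (?t x) = ennreal (integral {0..2 * x - 2 * a} F / (2 * x - 2 * a))"
    unfolding nn_mean_eq[symmetric] uda_law_Trap[OF ab x']
    by (rule nn_mean_bind_eq[where B = "x / c"]) (use x nn F0 FB steps_measurable in auto)
  moreover have "0 \<le> integral {0..2 * x - 2 * a} F"
    by (cases "F integrable_on {0..2 * x - 2 * a}") (auto simp: F0 not_integrable_integral intro: integral_nonneg)
  ultimately have "?t x = integral {0..2 * x - 2 * a} F / (2 * x - 2 * a)"
    using mean_nonneg(2)[of x] x by (subst (asm) ennreal_inj) auto
  moreover have "integral {0..2 * x - 2 * a} F =
      integral {0..s} (\<lambda>\<tau>. 1 + ?t (\<tau> + (a - c)) + ?t ((x - a) - \<tau>)) +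
      integral {s..2 * x - 2 * a} (\<lambda>\<tau>. 1 + ?p (\<tau> + (- s)) + ?p ((2 * x - 2 * a) - \<tau>))"
    unfolding F_def using x s by (intro integral_if_less integrable_add integrable_const_ivl mean_integrable mean_integrable_reflect) auto
  moreover have "integral {0..s} (\<lambda>\<tau>. 1 + ?t (\<tau> + (a - c)) + ?t ((x - a) - \<tau>)) =
      s + integral {a - c..x - a} ?t + integral {a - c..x - a} ?t"
    using s(1)
    by (simp add: Henstock_Kurzweil_Integration.integral_add integrable_add integrable_const_ivl mean_integrable mean_integrable_reflect
        integral_reflect_about integral_shift_by s(4,5))
  moreover have "integral {s..2 * x - 2 * a} (\<lambda>\<tau>. 1 + ?p (\<tau> + (- s)) + ?p ((2 * x - 2 * a) - \<tau>)) =
      (x - c) + integral {0..x - c} ?p + integral {0..x - c} ?p"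
    unfolding s(3) using x c_facts
    by (simp add: Henstock_Kurzweil_Integration.integral_add integrable_add integrable_const_ivl mean_integrable mean_integrable_reflect
        integral_reflect_about integral_shift_by_minus
        mean_integrable_reflect(3)[of "- s", simplified])
  moreover have "integral {a - c..x - a} ?t = integral {0..x - a} ?t"
    using mean_T_integral_from_0[of s] s by simp
  ultimately have "?t x * (2 * x - 2 * a) = (s + (x - c)) + 2 * integral {0..x - a} ?t + 2 * integral {0..x - c} ?p"
    using x by (simp add: field_simps)
  then show ?thesis
    unfolding s(3)[symmetric] by (simp add: algebra_simps)
qed

text \<open>The two equations are interchanged by swapping \<open>P\<close> and \<open>T\<close>, so their mean closes.\<close>

lemma eta_equation:
  assumes "a < x"
  shows "(x - a) * (eta a b x - 1) = integral {0..x - a} (eta a b) + integral {0..x - c} (eta a b)"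
proof -
  have "integral {0..y} (eta a b) = (integral {0..y} (mean_P a b) + integral {0..y} (mean_T a b)) / 2" for y
    unfolding eta_def by (simp add: Henstock_Kurzweil_Integration.integral_add mean_integrable)
  then show ?thesis
    using mean_P_equation[OF assms] mean_T_equation[OF assms] by (simp add: eta_def field_simps)
qed

lemma eta_initial:
  "x < c \<Longrightarrow> eta a b x = 0" "c \<le> x \<Longrightarrow> x < a \<Longrightarrow> eta a b x = 1 / 2"
  using c_facts mean_T_small[of x] by (auto simp: eta_def mean_small)

lemma eta_integrable: "eta a b integrable_on {u..v}"
  unfolding eta_def[abs_def] by (intro integrable_on_divide integrable_add mean_integrable)

lemma eta_bounds: "0 \<le> eta a b x" "0 \<le> x \<Longrightarrow> eta a b x \<le> x / c"
  using mean_nonneg[of x] mean_le[of x] by (auto simp: eta_def)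

end
section \<open>The exponential integral\<close>

text \<open>The continuous extension to \<open>0\<close> of \<open>(1 - exp(-t)) / t\<close>.\<close>

definition Ein_density :: "real \<Rightarrow> real" where
  "Ein_density t = (if t = 0 then 1 else (1 - exp (- t)) / t)"

text \<open>
  The entire exponential integral, on the non-negative reals. On the negative reals the value is \<open>0\<close>, since the
  interval of integration is empty; this keeps the function continuous.
\<close>

definition Ein :: "real \<Rightarrow> real" where
  "Ein x = integral {0..x} Ein_density"

lemma continuous_Ein_density: "continuous_on UNIV Ein_density"
proof -
  have "isCont Ein_density t" for t
  proof (cases "t = 0")
    case True
    have "((\<lambda>t::real. 1 - exp (- t)) has_real_derivative 1) (at 0)"
      by (auto intro!: derivative_eq_intros)
    then have "((\<lambda>t::real. (1 - exp (- t)) / t) \<longlongrightarrow> 1) (at 0)"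
      by (simp add: has_field_derivative_iff)
    moreover have "\<forall>\<^sub>F t in at 0. (1 - exp (- t)) / t = Ein_density t"
      by (auto simp: eventually_at_filter Ein_density_def)
    ultimately have "(Ein_density \<longlongrightarrow> 1) (at 0)"
      by (rule Lim_transform_eventually)
    then show ?thesis
      using True by (simp add: isCont_def Ein_density_def)
  next
    case False
    have "isCont (\<lambda>t. (1 - exp (- t)) / t) t"
      using False by (intro continuous_intros) auto
    moreover have "\<forall>\<^sub>F s in nhds t. (1 - exp (- s)) / s = Ein_density s"
      using False by (intro eventually_nhds_in_open[of "- {0}", THEN eventually_mono])
        (auto simp: Ein_density_def)
    ultimately show ?thesis
      by (simp cong: isCont_cong)
  qed
  then show ?thesis
    by (simp add: continuous_on_eq_continuous_at)
qed

lemma Ein_density_nonneg: "Ein_density t \<ge> 0"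
  by (cases "0 \<le> t") (auto simp: Ein_density_def intro: divide_nonpos_nonpos divide_nonneg_nonneg)

lemma Ein_nonpos [simp]: "x \<le> 0 \<Longrightarrow> Ein x = 0"
  by (cases "x = 0") (auto simp: Ein_def)

lemma has_derivative_Ein_within:
  assumes "0 \<le> x" "x \<le> b"
  shows "(Ein has_real_derivative Ein_density x) (at x within {0..b})"
  unfolding Ein_def has_real_derivative_iff_has_vector_derivative
  using assms continuous_Ein_density
  by (intro integral_has_vector_derivative) (auto intro: continuous_on_subset)

lemma has_derivative_Ein [derivative_intros]:
  assumes "0 < x"
  shows "(Ein has_real_derivative (1 - exp (- x)) / x) (at x)"
proof -
  have "(Ein has_real_derivative Ein_density x) (at x within {0..x + 1})"
    using assms by (intro has_derivative_Ein_within) auto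
  moreover have "at x within {0..x + 1} = at x"
    using assms by (intro at_within_interior) auto
  ultimately show ?thesis
    using assms by (simp add: Ein_density_def)
qed

lemmas DERIV_Ein_chain [derivative_intros] = DERIV_chain2 [OF has_derivative_Ein]

lemma continuous_Ein: "continuous_on UNIV Ein"
proof -
  have "continuous_on ({..0} \<union> {0..b}) Ein" for b
  proof (rule continuous_on_closed_Un)
    have "continuous_on {..0::real} (\<lambda>x. 0::real)"
      by simp
    then show "continuous_on {..0} Ein"
      by (rule continuous_on_cong[THEN iffD1, rotated -1]) auto
    show "continuous_on {0..b} Ein"
      using has_derivative_Ein_within by (auto intro!: DERIV_continuous_on)
  qed auto
  then have *: "continuous_on {..<b} Ein" for b
    by (rule continuous_on_subset[where s = "{..0} \<union> {0..b}"]) auto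
  have "isCont Ein x" for x
    using *[of "x + 1"] by (auto simp: continuous_on_eq_continuous_at)
  then show ?thesis
    by (simp add: continuous_on_eq_continuous_at)
qed

lemmas continuous_on_Ein [continuous_intros] =
  continuous_on_compose2 [OF continuous_Ein _ subset_UNIV]

lemma borel_measurable_Ein [measurable]: "Ein \<in> borel_measurable borel"
  by (rule borel_measurable_continuous_onI) (rule continuous_Ein)

lemma Ein_nonneg: "Ein x \<ge> 0"
  unfolding Ein_def
  by (rule integral_nonneg)
    (auto intro: Ein_density_nonneg integrable_continuous_real continuous_on_subset[OF continuous_Ein_density])

lemma Ein_mono: "x \<le> y \<Longrightarrow> Ein x \<le> Ein y"
  unfolding Ein_def
  by (rule integral_subset_le)
    (auto intro: Ein_density_nonneg integrable_continuous_real continuous_on_subset[OF continuous_Ein_density])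

text \<open>
  The function \<open>x exp(-Ein(x))\<close> increases from \<open>0\<close> and is at most \<open>1\<close>, so that
  \<open>Ein(x)\<close> and \<open>ln x\<close> differ by a bounded amount for \<open>x \<ge> 1\<close>.
\<close>

lemma has_derivative_times_exp_Ein:
  assumes "0 < x"
  shows "((\<lambda>x. x * exp (- Ein x)) has_real_derivative exp (- Ein x - x)) (at x)"
  using assms by (auto intro!: derivative_eq_intros simp: field_simps exp_diff exp_minus)

lemma times_exp_Ein_le_1:
  assumes "0 \<le> x"
  shows "x * exp (- Ein x) \<le> 1"
proof -
  have "x * exp (- Ein x) + exp (- x) \<le> 0 * exp (- Ein 0) + exp (- 0)"
  proof (rule DERIV_nonpos_imp_decreasing_open[where f = "\<lambda>x. x * exp (- Ein x) + exp (- x)"])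
    fix y assume "0 < y" "y < x"
    have "((\<lambda>x. x * exp (- Ein x) + exp (- x)) has_real_derivative exp (- Ein y - y) - exp (- y)) (at y)"
      using \<open>0 < y\<close> by (auto intro!: derivative_eq_intros simp: field_simps exp_diff exp_minus)
    moreover have "exp (- Ein y - y) - exp (- y) \<le> 0"
      using Ein_nonneg[of y] by simp
    ultimately show "\<exists>z. ((\<lambda>x. x * exp (- Ein x) + exp (- x)) has_real_derivative z) (at y) \<and> z \<le> 0"
      by blast
  qed (use assms in \<open>auto intro!: continuous_intros\<close>)
  also have "\<dots> = 1"
    by simp
  finally show ?thesis
    using exp_gt_zero[of "- x"] by linarith
qed

lemma Ein_le_self: "0 \<le> x \<Longrightarrow> Ein x \<le> x"
proof -
  assume x: "0 \<le> x"
  have "Ein_density t \<le> 1" if "0 \<le> t" for t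
    using that exp_ge_add_one_self[of "-t"] by (auto simp: Ein_density_def divide_le_eq_1)
  then have "integral {0..x} Ein_density \<le> integral {0..x} (\<lambda>_. 1)"
    by (intro integral_le integrable_continuous_real continuous_on_subset[OF continuous_Ein_density]) auto
  then show ?thesis
    using x by (simp add: Ein_def)
qed

lemma times_exp_Ein_ge:
  assumes "1 \<le> x"
  shows "exp (- 1) \<le> x * exp (- Ein x)"
proof -
  have "1 * exp (- Ein 1) \<le> x * exp (- Ein x)"
    using assms
    by (intro DERIV_nonneg_imp_nondecreasing[where f = "\<lambda>x. x * exp (- Ein x)"])
      (auto intro!: exI conjI has_derivative_times_exp_Ein)
  moreover have "exp (- 1) \<le> exp (- Ein 1)"
    using Ein_le_self[of 1] by simp
  ultimately show ?thesis by linarith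
qed

section \<open>Integrals over the half-line\<close>

text \<open>
  By the mean value theorem the bound \<open>w\<close> for the derivative in the parameter also bounds the difference
  quotients, so dominated convergence applies to them.
\<close>

lemma has_derivative_integral_dominated:
  fixes f f' :: "real \<Rightarrow> 'a \<Rightarrow> real"
  assumes x: "l < x" "x < r"
    and int: "\<And>y. l < y \<Longrightarrow> y < r \<Longrightarrow> integrable M (f y)"
    and meas: "f' x \<in> borel_measurable M"
    and deriv: "\<And>y s. s \<in> space M \<Longrightarrow> l < y \<Longrightarrow> y < r \<Longrightarrow> ((\<lambda>y. f y s) has_real_derivative f' y s) (at y)"
    and bound: "\<And>y s. s \<in> space M \<Longrightarrow> l < y \<Longrightarrow> y < r \<Longrightarrow> \<bar>f' y s\<bar> \<le> w s"
    and w: "integrable M w"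
  shows "((\<lambda>y. \<integral>s. f y s \<partial>M) has_real_derivative (\<integral>s. f' x s \<partial>M)) (at x)"
    and "integrable M (f' x)"
proof -
  show i': "integrable M (f' x)"
    using meas bound x by (intro Bochner_Integration.integrable_bound[OF w]) (auto intro!: AE_I2 order_trans[OF bound])
  show "((\<lambda>y. \<integral>s. f y s \<partial>M) has_real_derivative (\<integral>s. f' x s \<partial>M)) (at x)"
    unfolding has_field_derivative_iff tendsto_at_iff_sequentially comp_def
  proof (intro allI impI)
    fix X :: "nat \<Rightarrow> real"
    assume X: "\<forall>i. X i \<in> UNIV - {x}" "X \<longlonglongrightarrow> x"
    define g where "g i s = (if l < X i \<and> X i < r then (f (X i) s - f x s) / (X i - x) else 0)" for i s
    have ev: "\<forall>\<^sub>F i in sequentially. l < X i \<and> X i < r"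
      using order_tendstoD[OF X(2)] x by (auto intro: eventually_conj)
    have gm: "g i \<in> borel_measurable M" for i
      unfolding g_def using int x by (cases "l < X i \<and> X i < r") auto
    have "(\<lambda>i. \<integral>s. g i s \<partial>M) \<longlonglongrightarrow> (\<integral>s. f' x s \<partial>M)"
    proof (rule integral_dominated_convergence[OF meas gm w])
      show "AE s in M. (\<lambda>i. g i s) \<longlonglongrightarrow> f' x s"
      proof (rule AE_I2)
        fix s assume s: "s \<in> space M"
        have "(\<lambda>i. (f (X i) s - f x s) / (X i - x)) \<longlonglongrightarrow> f' x s"
          using deriv[OF s x] X
          unfolding has_field_derivative_iff tendsto_at_iff_sequentially comp_def by blast
        then show "(\<lambda>i. g i s) \<longlonglongrightarrow> f' x s"
          by (rule Lim_transform_eventually) (use ev in eventually_elim, simp add: g_def)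
      qed
      fix i
      show "AE s in M. norm (g i s) \<le> w s"
      proof (rule AE_I2)
        fix s assume s: "s \<in> space M"
        have w0: "0 \<le> w s"
          using bound[OF s x] by linarith
        show "norm (g i s) \<le> w s"
        proof (cases "l < X i \<and> X i < r")
          case True
          have "\<exists>z. l < z \<and> z < r \<and> f (X i) s - f x s = (X i - x) * f' z s"
          proof (cases "X i < x")
            case less: True
            obtain z where "X i < z" "z < x" "f x s - f (X i) s = (x - X i) * f' z s"
              using MVT2[OF less, of "\<lambda>y. f y s" "\<lambda>y. f' y s"] deriv[OF s] True x by force
            then show ?thesis
              using True x by (intro exI[of _ z]) (auto simp: algebra_simps)
          next
            case False
            then have less: "x < X i"
              using X(1) by (auto simp: not_less le_less)
            obtain z where "x < z" "z < X i" "f (X i) s - f x s = (X i - x) * f' z s"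
              using MVT2[OF less, of "\<lambda>y. f y s" "\<lambda>y. f' y s"] deriv[OF s] True x by force
            then show ?thesis
              using True x by (intro exI[of _ z]) auto
          qed
          then obtain z where z: "l < z" "z < r" "f (X i) s - f x s = (X i - x) * f' z s"
            by blast
          then have "g i s = f' z s"
            using True X(1) by (simp add: g_def)
          then show ?thesis
            using bound[OF s z(1,2)] by simp
        qed (use w0 in \<open>auto simp: g_def\<close>)
      qed
    qed
    moreover have "\<forall>\<^sub>F i in sequentially. (\<integral>s. g i s \<partial>M) = ((\<integral>s. f (X i) s \<partial>M) - (\<integral>s. f x s \<partial>M)) / (X i - x)"
      using ev
    proof eventually_elim
      case (elim i)
      then show ?case
        using int[of "X i"] int[OF x] by (simp add: g_def)
    qed
    ultimately show "(\<lambda>i. ((\<integral>s. f (X i) s \<partial>M) - (\<integral>s. f x s \<partial>M)) / (X i - x)) \<longlonglongrightarrow> (\<integral>s. f' x s \<partial>M)"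
      by (rule Lim_transform_eventually)
  qed
qed

text \<open>Lebesgue measure on the positive reals.\<close>

abbreviation half_line :: "real measure" where
  "half_line \<equiv> restrict_space lborel {0<..}"

lemma half_line_integrable_iff: "integrable half_line f \<longleftrightarrow> set_integrable lborel {0<..} f"
  for f :: "real \<Rightarrow> real"
  by (simp add: integrable_restrict_space set_integrable_def)

lemma half_line_integral_eq: "integral\<^sup>L half_line f = (LINT s:{0<..}|lborel. f s)"
  for f :: "real \<Rightarrow> real"
  by (simp add: integral_restrict_space set_lebesgue_integral_def)

lemma borel_measurable_half_line [measurable (raw)]:
  "f \<in> borel_measurable borel \<Longrightarrow> f \<in> borel_measurable half_line"
  by (intro measurable_restrict_space1) simp

lemma space_half_line [simp]: "space half_line = {0<..}"
  by (simp add: space_restrict_space)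

lemma half_line_FTC:
  fixes F f :: "real \<Rightarrow> real"
  assumes "\<And>s. 0 < s \<Longrightarrow> (F has_real_derivative f s) (at s)" "\<And>s. 0 < s \<Longrightarrow> isCont f s"
    and "integrable half_line f"
    and "(F \<longlongrightarrow> A) (at_right 0)" "(F \<longlongrightarrow> B) at_top"
  shows "integral\<^sup>L half_line f = B - A"
proof -
  have "(LBINT s=ereal 0..\<infinity>. f s) = B - A"
    by (rule interval_integral_FTC_integrable)
      (use assms in \<open>auto simp: has_real_derivative_iff_has_vector_derivative half_line_integrable_iff
         ereal_tendsto_simps einterval_eq\<close>)
  then show ?thesis
    by (simp add: half_line_integral_eq interval_lebesgue_integral_def einterval_eq)
qed

lemma half_line_FTC_nonneg:
  fixes F f :: "real \<Rightarrow> real"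
  assumes "\<And>s. 0 < s \<Longrightarrow> (F has_real_derivative f s) (at s)" "\<And>s. 0 < s \<Longrightarrow> isCont f s"
    and "\<And>s. 0 < s \<Longrightarrow> 0 \<le> f s"
    and "(F \<longlongrightarrow> A) (at_right 0)" "(F \<longlongrightarrow> B) at_top"
  shows "integrable half_line f" "integral\<^sup>L half_line f = B - A"
proof -
  have "set_integrable lborel (einterval (ereal 0) \<infinity>) f" "(LBINT s=ereal 0..\<infinity>. f s) = B - A"
    by (rule interval_integral_FTC_nonneg[where F = F and A = A and B = B];
        use assms in \<open>auto simp: ereal_tendsto_simps\<close>)+
  then show "integrable half_line f" "integral\<^sup>L half_line f = B - A"
    by (simp_all add: half_line_integrable_iff half_line_integral_eq interval_lebesgue_integral_def einterval_eq)
qed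

lemma half_line_exp:
  assumes "0 < k"
  shows "integrable half_line (\<lambda>s. exp (- (k * s)))" "(\<integral>s. exp (- (k * s)) \<partial>half_line) = 1 / k"
proof -
  have 1: "((\<lambda>s. - exp (- (k * s)) / k) has_real_derivative exp (- (k * s))) (at s)" for s
    using assms by (auto intro!: derivative_eq_intros)
  have 2: "((\<lambda>s. - exp (- (k * s)) / k) \<longlongrightarrow> - 1 / k) (at_right 0)"
    using assms by (auto intro!: tendsto_eq_intros)
  have "((\<lambda>s. exp (- (k * s))) \<longlongrightarrow> 0) at_top"
    using assms by real_asymp
  from tendsto_divide[OF tendsto_minus[OF this] tendsto_const[of k]] assms
  have 3: "((\<lambda>s. - exp (- (k * s)) / k) \<longlongrightarrow> 0) at_top"
    by simp
  show "integrable half_line (\<lambda>s. exp (- (k * s)))" "(\<integral>s. exp (- (k * s)) \<partial>half_line) = 1 / k"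
    using half_line_FTC_nonneg[OF 1 _ _ 2 3] by auto
qed

lemma half_line_power2_exp:
  assumes "0 < k"
  shows "integrable half_line (\<lambda>s. s\<^sup>2 * exp (- (k * s)))" "(\<integral>s. s\<^sup>2 * exp (- (k * s)) \<partial>half_line) = 2 / k ^ 3"
proof -
  define F where "F s = - (s\<^sup>2 / k + 2 * s / k\<^sup>2 + 2 / k ^ 3) * exp (- (k * s))" for s
  have 1: "(F has_real_derivative s\<^sup>2 * exp (- (k * s))) (at s)" for s
    unfolding F_def[abs_def] using assms
    by (auto intro!: derivative_eq_intros simp: field_simps power2_eq_square power3_eq_cube)
  have 2: "(F \<longlongrightarrow> - (2 / k ^ 3)) (at_right 0)"
    unfolding F_def[abs_def] using assms by (auto intro!: tendsto_eq_intros)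
  have 3: "(F \<longlongrightarrow> 0) at_top"
    unfolding F_def[abs_def] using assms by real_asymp
  show "integrable half_line (\<lambda>s. s\<^sup>2 * exp (- (k * s)))" "(\<integral>s. s\<^sup>2 * exp (- (k * s)) \<partial>half_line) = 2 / k ^ 3"
    using half_line_FTC_nonneg[OF 1 _ _ 2 3] by auto
qed

lemma half_line_times_exp:
  assumes "0 < k"
  shows "integrable half_line (\<lambda>s. s * exp (- (k * s)))"
proof (rule Bochner_Integration.integrable_bound)
  show "integrable half_line (\<lambda>s. exp (- (k * s)) + s\<^sup>2 * exp (- (k * s)))"
    using half_line_exp(1)[OF assms] half_line_power2_exp(1)[OF assms] by auto
  have "s \<le> 1 + s\<^sup>2" for s :: real
    using sum_power2_ge_zero[of "s - 1" 1] by (simp add: power2_eq_square algebra_simps) (smt (verit) zero_le_square)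
  then have "s * exp (- (k * s)) \<le> exp (- (k * s)) + s\<^sup>2 * exp (- (k * s))" for s
    using mult_right_mono[of s "1 + s\<^sup>2" "exp (- (k * s))"] by (simp add: algebra_simps)
  then show "AE s in half_line. norm (s * exp (- (k * s))) \<le> norm (exp (- (k * s)) + s\<^sup>2 * exp (- (k * s)))"
    by (intro AE_I2) (auto simp: abs_mult)
qed simp

lemma half_line_integrable_bound:
  fixes f g :: "real \<Rightarrow> real"
  assumes "integrable half_line g" "f \<in> borel_measurable borel" "\<And>s. 0 < s \<Longrightarrow> \<bar>f s\<bar> \<le> g s"
  shows "integrable half_line f"
  by (rule Bochner_Integration.integrable_bound[OF assms(1)])
    (use assms(2,3) in \<open>auto intro!: AE_I2 intro: order_trans[OF _ abs_ge_self]\<close>)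

lemma half_line_integral_less:
  fixes f g :: "real \<Rightarrow> real"
  assumes "integrable half_line f" "integrable half_line g" "\<And>s. 0 < s \<Longrightarrow> f s < g s"
  shows "integral\<^sup>L half_line f < integral\<^sup>L half_line g"
proof -
  have "integral\<^sup>L half_line (\<lambda>s. g s - f s) \<noteq> 0"
  proof
    assume "integral\<^sup>L half_line (\<lambda>s. g s - f s) = 0"
    then have "AE s in half_line. g s - f s = 0"
      using assms by (subst (asm) integral_nonneg_eq_0_iff_AE) (auto intro!: AE_I2 less_imp_le)
    moreover have "AE s in half_line. g s - f s \<noteq> 0"
      using assms(3) by (intro AE_I2) force
    ultimately have "AE s in half_line. False"
      by eventually_elim simp
    then have "AE s in lborel. s \<in> {0<..1::real} \<longrightarrow> False"
      by (subst (asm) AE_restrict_space_iff) auto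
    then have "emeasure lborel {0<..1::real} = 0"
      by (subst (asm) AE_iff_measurable[of "{0<..1}"]) auto
    then show False by simp
  qed
  moreover have "0 \<le> integral\<^sup>L half_line (\<lambda>s. g s - f s)"
    using assms(3) by (intro Bochner_Integration.integral_nonneg) (auto intro: less_imp_le)
  ultimately show ?thesis
    using assms(1,2) by simp
qed

section \<open>The adjoint equation\<close>

text \<open>
  The weight \<open>w\<^sub>c\<close> in the formula for the limit density, written \<open>weight c s\<close>.
\<close>

definition weight :: "real \<Rightarrow> real \<Rightarrow> real" where
  "weight c s = exp (- Ein s - Ein (c * s))"

lemma borel_measurable_weight [measurable]: "weight c \<in> borel_measurable borel"
  unfolding weight_def[abs_def] by measurable

lemma weight_pos: "0 < weight c s" and weight_le_1: "weight c s \<le> 1"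
  using Ein_nonneg[of s] Ein_nonneg[of "c * s"] by (auto simp: weight_def)

lemma abs_weight [simp]: "\<bar>weight c s\<bar> = weight c s"
  using weight_pos[of c s] by simp

lemma continuous_weight [continuous_intros]: "continuous_on S f \<Longrightarrow> continuous_on S (\<lambda>s. weight c (f s))"
  unfolding weight_def by (intro continuous_intros)

lemma has_derivative_weight:
  assumes "0 < c" "0 < s"
  shows "(weight c has_real_derivative - weight c s * (2 - exp (- s) - exp (- (c * s))) / s) (at s)"
  unfolding weight_def[abs_def] using assms
  by (auto intro!: derivative_eq_intros simp: field_simps)

lemmas DERIV_weight [derivative_intros] = DERIV_chain2 [OF has_derivative_weight]

lemma weight_times_power2_le:
  assumes "0 < c" "0 \<le> s"
  shows "s\<^sup>2 * weight c s \<le> 1 / c"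
proof -
  have "(s * exp (- Ein s)) * ((c * s) * exp (- Ein (c * s))) \<le> 1 * 1"
    using assms by (intro mult_mono times_exp_Ein_le_1) auto
  then show ?thesis
    using assms by (simp add: weight_def field_simps power2_eq_square exp_diff exp_minus)
qed

lemma weight_ge_exp:
  assumes "0 < c" "c \<le> 1" "0 \<le> s"
  shows "exp (- (2 * s)) \<le> weight c s"
proof -
  have "Ein s \<le> s" "Ein (c * s) \<le> c * s" "c * s \<le> s"
    using assms by (auto intro!: Ein_le_self mult_left_le_one_le)
  then show ?thesis
    by (simp add: weight_def)
qed

lemma weight_integrable:
  assumes "0 < c"
  shows "integrable half_line (weight c)"
proof -
  have 1: "((\<lambda>s. s / (1 + s)) has_real_derivative 1 / (1 + s)\<^sup>2) (at s)" if "0 < s" for s :: real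
    using that by (auto intro!: derivative_eq_intros simp: field_simps power2_eq_square)
  have 2: "((\<lambda>s::real. s / (1 + s)) \<longlongrightarrow> 0) (at_right 0)"
    by (auto intro!: tendsto_eq_intros)
  have 3: "((\<lambda>s::real. s / (1 + s)) \<longlongrightarrow> 1) at_top"
    by real_asymp
  have "integrable half_line (\<lambda>s. 1 / (1 + s)\<^sup>2)"
    by (rule half_line_FTC_nonneg(1)[OF 1 _ _ 2 3]) (auto intro!: continuous_intros)
  then have i: "integrable half_line (\<lambda>s. (2 + 2 / c) * (1 / (1 + s)\<^sup>2))"
    by (rule integrable_mult_right)
  show ?thesis
  proof (rule half_line_integrable_bound[OF i])
    fix s :: real assume s: "0 < s"
    have "(1 + s)\<^sup>2 * weight c s \<le> (2 + 2 * s\<^sup>2) * weight c s"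
      using weight_pos[of c s] zero_le_power2[of "s - 1"]
      by (intro mult_right_mono) (auto simp: power2_eq_square algebra_simps)
    also have "\<dots> \<le> 2 + 2 / c"
      using weight_times_power2_le[OF assms, of s] weight_le_1[of c s] s by (simp add: algebra_simps)
    finally show "\<bar>weight c s\<bar> \<le> (2 + 2 / c) * (1 / (1 + s)\<^sup>2)"
      using s weight_pos[of c s] by (simp add: field_simps)
  qed simp
qed

text \<open>
  The solution \<open>q\<close> of the adjoint equation, for \<open>x > 1\<close>, and the product \<open>(x - 1) q(x)\<close>. The latter is given by
  its own integral, which still converges at \<open>x = 1\<close>.
\<close>

definition adjoint_solution :: "real \<Rightarrow> real \<Rightarrow> real" where
  "adjoint_solution c x = (\<integral>s. s\<^sup>2 * exp (- ((x - 1) * s)) * weight c s \<partial>half_line)"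

definition adjoint_times :: "real \<Rightarrow> real \<Rightarrow> real" where
  "adjoint_times c x = (\<integral>s. s * (exp (- s) + exp (- (c * s))) * exp (- ((x - 1) * s)) * weight c s \<partial>half_line)"

lemma adjoint_integrable:
  assumes "1 < x"
  shows "integrable half_line (\<lambda>s. s\<^sup>2 * exp (- ((x - 1) * s)) * weight c s)"
  by (rule half_line_integrable_bound[OF half_line_power2_exp(1)[of "x - 1"]])
    (use assms in \<open>auto simp: abs_mult weight_le_1 intro!: mult_left_le\<close>)

lemma adjoint_nonneg: "0 \<le> adjoint_solution c x"
  unfolding adjoint_solution_def
  by (intro Bochner_Integration.integral_nonneg) (simp add: less_imp_le[OF weight_pos])

lemma adjoint_le:
  assumes "1 < x"
  shows "adjoint_solution c x \<le> 2 / (x - 1) ^ 3"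
proof -
  have "adjoint_solution c x \<le> (\<integral>s. s\<^sup>2 * exp (- ((x - 1) * s)) \<partial>half_line)"
    unfolding adjoint_solution_def using assms adjoint_integrable[OF assms] half_line_power2_exp[of "x - 1"]
    by (intro integral_mono) (auto intro!: mult_left_le simp: weight_le_1)
  also have "\<dots> = 2 / (x - 1) ^ 3"
    using assms half_line_power2_exp(2)[of "x - 1"] by simp
  finally show ?thesis .
qed

text \<open>Since \<open>Ein(x) \<le> x\<close>, the weight is at least \<open>exp(-2 s)\<close>.\<close>

lemma adjoint_ge:
  assumes "0 < c" "c \<le> 1" "1 < x"
  shows "2 / (x + 1) ^ 3 \<le> adjoint_solution c x"
proof -
  have "2 / (x + 1) ^ 3 = (\<integral>s. s\<^sup>2 * exp (- ((x + 1) * s)) \<partial>half_line)"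
    using assms half_line_power2_exp(2)[of "x + 1"] by simp
  also have "\<dots> \<le> adjoint_solution c x"
    unfolding adjoint_solution_def
  proof (rule integral_mono)
    fix s :: real assume "s \<in> space half_line"
    then have "exp (- ((x - 1) * s)) * exp (- (2 * s)) \<le> exp (- ((x - 1) * s)) * weight c s"
      using weight_ge_exp[OF assms(1,2), of s] by simp
    moreover have "exp (- ((x - 1) * s)) * exp (- (2 * s)) = exp (- ((x + 1) * s))"
      by (simp add: exp_add[symmetric] algebra_simps)
    ultimately show "s\<^sup>2 * exp (- ((x + 1) * s)) \<le> s\<^sup>2 * exp (- ((x - 1) * s)) * weight c s"
      by (metis mult.assoc mult_left_mono zero_le_power2)
  qed (use assms adjoint_integrable half_line_power2_exp in auto)
  finally show ?thesis .
qed

lemma adjoint_times_bound: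
  fixes c d :: real
  assumes "1 / 2 \<le> c" "0 < s" "d \<le> x"
  shows "\<bar>(exp (- s) + exp (- (c * s))) * exp (- ((x - 1) * s)) * weight c s\<bar> \<le> 2 * exp (- ((d - 1 / 2) * s))"
proof -
  have "exp (- s) \<le> exp (- (s / 2))" "exp (- (c * s)) \<le> exp (- (s / 2))" "exp (- ((x - 1) * s)) \<le> exp (- ((d - 1) * s))"
    using assms by (auto intro: mult_right_mono)
  moreover from this have "exp (- s) + exp (- (c * s)) \<le> 2 * exp (- (s / 2))"
    by linarith
  ultimately have "(exp (- s) + exp (- (c * s))) * exp (- ((x - 1) * s)) * weight c s \<le> (2 * exp (- (s / 2))) * exp (- ((d - 1) * s)) * 1"
    using assms by (intro mult_mono weight_le_1) (auto simp: less_imp_le[OF weight_pos] intro: add_nonneg_nonneg)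
  also have "\<dots> = 2 * exp (- ((d - 1 / 2) * s))"
    by (simp add: exp_add[symmetric] algebra_simps)
  finally show ?thesis
    by (simp add: less_imp_le[OF weight_pos] abs_mult)
qed

text \<open>
  Integration by parts: the derivative of \<open>s\<^sup>2 exp(-(x - 1) s) weight c s\<close> is the difference of the two integrands.
\<close>

lemma adjoint_times_eq:
  assumes "1 / 2 \<le> c" "1 < x"
  shows "adjoint_times c x = (x - 1) * adjoint_solution c x"
proof -
  let ?k = "x - 1"
  have i1: "integrable half_line (\<lambda>s. s * (exp (- s) + exp (- (c * s))) * exp (- (?k * s)) * weight c s)"
  proof (rule half_line_integrable_bound)
    show "integrable half_line (\<lambda>s. 2 * (s * exp (- ((1 - 1 / 2) * s))))"
      by (intro integrable_mult_right half_line_times_exp) simp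
    fix s :: real assume "0 < s"
    then show "\<bar>s * (exp (- s) + exp (- (c * s))) * exp (- (?k * s)) * weight c s\<bar> \<le> 2 * (s * exp (- ((1 - 1 / 2) * s)))"
      using mult_left_mono[OF adjoint_times_bound[of c s 1 x], of s] assms by (simp add: abs_mult mult_ac)
  qed measurable
  have i2: "integrable half_line (\<lambda>s. ?k * (s\<^sup>2 * exp (- (?k * s)) * weight c s))"
    using adjoint_integrable[OF assms(2)] by (intro integrable_mult_right)
  define F where "F s = s\<^sup>2 * exp (- (?k * s)) * weight c s" for s
  have "(\<integral>s. s * (exp (- s) + exp (- (c * s))) * exp (- (?k * s)) * weight c s
      - ?k * (s\<^sup>2 * exp (- (?k * s)) * weight c s) \<partial>half_line) = 0 - 0"
  proof (rule half_line_FTC[where F = F])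
    fix s :: real assume s: "0 < s"
    show "(F has_real_derivative s * (exp (- s) + exp (- (c * s))) * exp (- (?k * s)) * weight c s
      - ?k * (s\<^sup>2 * exp (- (?k * s)) * weight c s)) (at s)"
      unfolding F_def[abs_def] using s assms
      by (auto intro!: derivative_eq_intros simp: field_simps power2_eq_square)
    show "isCont (\<lambda>s. s * (exp (- s) + exp (- (c * s))) * exp (- (?k * s)) * weight c s
      - ?k * (s\<^sup>2 * exp (- (?k * s)) * weight c s)) s"
      by (rule continuous_on_interior[of UNIV]) (auto intro!: continuous_intros)
  next
    show "(F \<longlongrightarrow> 0) (at_right 0)"
    proof (rule tendsto_within_subset)
      have "continuous_on UNIV F"
        unfolding F_def[abs_def] by (intro continuous_intros)
      then show "(F \<longlongrightarrow> 0) (at 0)"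
        by (metis F_def UNIV_I continuous_on_def at_within_open open_UNIV mult_zero_left power_zero_numeral)
    qed simp
    have "((\<lambda>s. s\<^sup>2 * exp (- (?k * s))) \<longlongrightarrow> 0) at_top"
      using assms by real_asymp
    then show "(F \<longlongrightarrow> 0) at_top"
      by (rule Lim_null_comparison[rotated], intro always_eventually allI)
        (auto simp: F_def abs_mult weight_le_1 less_imp_le[OF weight_pos] intro!: mult_left_le)
  qed (use i1 i2 in \<open>rule Bochner_Integration.integrable_diff\<close>)
  then show ?thesis
    using i1 i2 adjoint_integrable[OF assms(2), of c] by (simp add: adjoint_times_def adjoint_solution_def)
qed

text \<open>The adjoint equation \<open>((x - 1) q(x))' = - q(x + 1) - q(x + c)\<close>.\<close>

lemma has_derivative_adjoint_times:
  assumes "1 / 2 \<le> c" "1 / 2 < x"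
  shows "(adjoint_times c has_real_derivative - adjoint_solution c (x + 1) - adjoint_solution c (x + c)) (at x)"
proof -
  define d where "d = (x + 1 / 2) / 2"
  have d: "1 / 2 < d" "d < x"
    using assms by (auto simp: d_def)
  define f where "f x s = s * (exp (- s) + exp (- (c * s))) * exp (- ((x - 1) * s)) * weight c s" for x s
  define f' where "f' x s = - (s\<^sup>2 * (exp (- s) + exp (- (c * s))) * exp (- ((x - 1) * s)) * weight c s)" for x s
  have eq: "f' x s = - (s\<^sup>2 * exp (- ((x + 1 - 1) * s)) * weight c s) - s\<^sup>2 * exp (- ((x + c - 1) * s)) * weight c s" for s
  proof -
    have "exp (- ((x + 1 - 1) * s)) = exp (- s) * exp (- ((x - 1) * s))"
      "exp (- ((x + c - 1) * s)) = exp (- (c * s)) * exp (- ((x - 1) * s))"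
      by (simp_all add: exp_add[symmetric] algebra_simps)
    then show ?thesis
      by (simp only: f'_def) (simp add: algebra_simps)
  qed
  have "((\<lambda>y. \<integral>s. f y s \<partial>half_line) has_real_derivative (\<integral>s. f' x s \<partial>half_line)) (at x)"
  proof (rule has_derivative_integral_dominated(1)[OF d(2), of "x + 1"])
    fix y assume y: "d < y"
    show "integrable half_line (f y)"
    proof (rule half_line_integrable_bound)
      show "integrable half_line (\<lambda>s. 2 * (s * exp (- ((d - 1 / 2) * s))))"
        using d by (intro integrable_mult_right half_line_times_exp) simp
      show "\<bar>f y s\<bar> \<le> 2 * (s * exp (- ((d - 1 / 2) * s)))" if "0 < s" for s
        using mult_left_mono[OF adjoint_times_bound[of c s d y], of s] assms that y by (simp add: f_def abs_mult mult_ac)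
    qed (simp add: f_def[abs_def])
  next
    show "integrable half_line (\<lambda>s. 2 * (s\<^sup>2 * exp (- ((d - 1 / 2) * s))))"
      using d by (intro integrable_mult_right half_line_power2_exp(1)) simp
    fix y s assume y: "s \<in> space half_line" "d < y"
    then show "\<bar>f' y s\<bar> \<le> 2 * (s\<^sup>2 * exp (- ((d - 1 / 2) * s)))"
      using mult_left_mono[OF adjoint_times_bound[of c s d y], of "s\<^sup>2"] assms by (simp add: f'_def abs_mult mult_ac)
    show "((\<lambda>y. f y s) has_real_derivative f' y s) (at y)"
      unfolding f_def f'_def by (auto intro!: derivative_eq_intros simp: power2_eq_square)
  qed (simp_all add: f'_def[abs_def])
  moreover have "(\<integral>s. f' x s \<partial>half_line) = - adjoint_solution c (x + 1) - adjoint_solution c (x + c)"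
    unfolding eq adjoint_solution_def
    using adjoint_integrable[of "x + 1" c] adjoint_integrable[of "x + c" c] assms by simp
  moreover have "adjoint_times c = (\<lambda>y. \<integral>s. f y s \<partial>half_line)"
    by (simp add: adjoint_times_def[abs_def] f_def)
  ultimately show ?thesis by simp
qed

lemma isCont_adjoint:
  assumes "1 / 2 \<le> c" "1 < x"
  shows "isCont (adjoint_solution c) x"
proof -
  have "isCont (\<lambda>x. adjoint_times c x / (x - 1)) x"
    using assms DERIV_isCont[OF has_derivative_adjoint_times[of c x]] by (intro continuous_intros) auto
  moreover have "\<forall>\<^sub>F y in nhds x. adjoint_times c y / (y - 1) = adjoint_solution c y"
    using assms adjoint_times_eq
    by (intro eventually_nhds_in_open[of "{1<..}", THEN eventually_mono]) auto
  ultimately show ?thesis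
    by (simp cong: isCont_cong)
qed

lemma tendsto_adjoint_times:
  assumes "1 / 2 \<le> c" "c \<le> 1"
  shows "((\<lambda>x. x\<^sup>2 * adjoint_times c x) \<longlongrightarrow> 2) at_top"
proof (rule tendsto_sandwich)
  show "\<forall>\<^sub>F x in at_top. x\<^sup>2 * ((x - 1) * (2 / (x + 1) ^ 3)) \<le> x\<^sup>2 * adjoint_times c x"
    using eventually_gt_at_top[of 1]
  proof eventually_elim
    case (elim x)
    then show ?case
      using adjoint_ge[of c x] assms by (simp only: adjoint_times_eq) (intro mult_left_mono, auto)
  qed
  show "\<forall>\<^sub>F x in at_top. x\<^sup>2 * adjoint_times c x \<le> x\<^sup>2 * ((x - 1) * (2 / (x - 1) ^ 3))"
    using eventually_gt_at_top[of 1]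
  proof eventually_elim
    case (elim x)
    then show ?case
      using adjoint_le[of x c] assms by (simp only: adjoint_times_eq) (intro mult_left_mono, auto)
  qed
  show "((\<lambda>x::real. x\<^sup>2 * ((x - 1) * (2 / (x + 1) ^ 3))) \<longlongrightarrow> 2) at_top" by real_asymp
  show "((\<lambda>x::real. x\<^sup>2 * ((x - 1) * (2 / (x - 1) ^ 3))) \<longlongrightarrow> 2) at_top" by real_asymp
qed

section \<open>The limit of the solutions of the delay equation\<close>

text \<open>The limit of \<open>\<eta>(x) / x\<close>.\<close>

definition limit_density :: "real \<Rightarrow> real" where
  "limit_density c = (\<integral>s. weight c s * (1 + exp (- (c * s)) + exp (- ((2 * c - 1) * s))) \<partial>half_line) / 2"

text \<open>
  The inhomogeneous term of the delay equation after subtracting from the solution its initial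
  part, which is \<open>1/2\<close> on \<open>[c, \<infinity>)\<close>.
\<close>

definition forcing :: "real \<Rightarrow> real \<Rightarrow> real" where
  "forcing c x = (max 0 (x - 1) + max 0 (x - (1 + c)) + max 0 (x - 2 * c)) / 2"

lemma forcing_nonneg: "0 \<le> forcing c x"
  by (simp add: forcing_def)

lemma borel_measurable_forcing [measurable]: "forcing c \<in> borel_measurable borel"
  unfolding forcing_def[abs_def] by measurable

lemma nn_integral_ramp_exp:
  assumes "1 \<le> k" "0 < s"
  shows "(\<integral>\<^sup>+y. ennreal (max 0 (y - k) * exp (- (y * s))) * indicator {1..} y \<partial>lborel) = ennreal (exp (- (k * s)) / s\<^sup>2)"
proof -
  define F where "F y = - ((y - k) / s + 1 / s\<^sup>2) * exp (- (y * s))" for y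
  have "(\<integral>\<^sup>+y. ennreal (max 0 (y - k) * exp (- (y * s))) * indicator {1..} y \<partial>lborel) =
      (\<integral>\<^sup>+y. ennreal ((y - k) * exp (- (y * s))) * indicator {k..} y \<partial>lborel)"
    using assms by (intro nn_integral_cong) (auto split: split_indicator)
  also have "\<dots> = ennreal (0 - F k)"
  proof (rule nn_integral_FTC_atLeast)
    show "(F has_real_derivative (y - k) * exp (- (y * s))) (at y)" for y
      unfolding F_def[abs_def] using assms
      by (auto intro!: derivative_eq_intros simp: field_simps power2_eq_square)
    show "(F \<longlongrightarrow> 0) at_top"
      unfolding F_def[abs_def] using assms by real_asymp
  qed auto
  also have "0 - F k = exp (- (k * s)) / s\<^sup>2"
    by (simp add: F_def)
  finally show ?thesis .
qed

lemma ennreal_half_sum3: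
  assumes "0 \<le> u" "0 \<le> v" "0 \<le> w"
  shows "ennreal (1 / 2) * (ennreal u + ennreal v + ennreal w) = ennreal ((u + v + w) / 2)"
proof -
  have "ennreal u + ennreal v + ennreal w = ennreal (u + v + w)"
    using assms by simp
  then show ?thesis
    using assms by (simp only:) (subst ennreal_mult[symmetric], auto)
qed

lemma nn_integral_forcing_exp:
  assumes "1 / 2 \<le> c" "0 < s"
  shows "(\<integral>\<^sup>+y. ennreal (forcing c y * exp (- (y * s))) * indicator {1..} y \<partial>lborel)
    = ennreal ((exp (- s) + exp (- ((1 + c) * s)) + exp (- (2 * c * s))) / (2 * s\<^sup>2))"
proof -
  have [measurable]: "(\<lambda>y. max 0 (y - k) * exp (- (y * s))) \<in> borel_measurable borel" for k :: real
    by measurable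
  let ?r = "\<lambda>k y. ennreal (max 0 (y - k) * exp (- (y * s))) * indicator {1..} y"
  have "(\<integral>\<^sup>+y. ennreal (forcing c y * exp (- (y * s))) * indicator {1..} y \<partial>lborel)
    = (\<integral>\<^sup>+y. ennreal (1 / 2) * (?r 1 y + ?r (1 + c) y + ?r (2 * c) y) \<partial>lborel)"
  proof (intro nn_integral_cong)
    fix y :: real
    have "ennreal (1 / 2) * (ennreal (max 0 (y - 1) * exp (- (y * s))) + ennreal (max 0 (y - (1 + c)) * exp (- (y * s)))
        + ennreal (max 0 (y - 2 * c) * exp (- (y * s)))) = ennreal (forcing c y * exp (- (y * s)))"
      by (subst ennreal_half_sum3) (auto simp: forcing_def algebra_simps)
    then show "ennreal (forcing c y * exp (- (y * s))) * indicator {1..} y =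
        ennreal (1 / 2) * (?r 1 y + ?r (1 + c) y + ?r (2 * c) y)"
      by (cases "1 \<le> y") simp_all
  qed
  also have "\<dots> = ennreal (1 / 2) * (ennreal (exp (- (1 * s)) / s\<^sup>2) + ennreal (exp (- ((1 + c) * s)) / s\<^sup>2) + ennreal (exp (- ((2 * c) * s)) / s\<^sup>2))"
    using assms by (simp add: nn_integral_cmult nn_integral_add nn_integral_ramp_exp del: mult_1)
  also have "\<dots> = ennreal ((exp (- s) + exp (- ((1 + c) * s)) + exp (- (2 * c * s))) / (2 * s\<^sup>2))"
  proof (subst ennreal_half_sum3)
    show "ennreal ((exp (- (1 * s)) / s\<^sup>2 + exp (- ((1 + c) * s)) / s\<^sup>2 + exp (- (2 * c * s)) / s\<^sup>2) / 2) =
        ennreal ((exp (- s) + exp (- ((1 + c) * s)) + exp (- (2 * c * s))) / (2 * s\<^sup>2))"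
      by (simp only: add_divide_distrib[symmetric] divide_divide_eq_left mult_1 mult.commute[of 2])
  qed auto
  finally show ?thesis .
qed

lemma limit_density_integrable:
  assumes "1 / 2 \<le> c"
  shows "integrable half_line (\<lambda>s. weight c s * (1 + exp (- (c * s)) + exp (- ((2 * c - 1) * s))))"
proof (rule half_line_integrable_bound)
  show "integrable half_line (\<lambda>s. weight c s * 3)"
    using assms by (intro integrable_mult_left weight_integrable) simp
  fix s :: real assume s: "0 < s"
  have "exp (- (c * s)) \<le> 1" "exp (- ((2 * c - 1) * s)) \<le> 1"
    using assms s by auto
  then have "1 + exp (- (c * s)) + exp (- ((2 * c - 1) * s)) \<le> 3"
    by linarith
  then show "\<bar>weight c s * (1 + exp (- (c * s)) + exp (- ((2 * c - 1) * s)))\<bar> \<le> weight c s * 3"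
    using mult_left_mono[OF _ less_imp_le[OF weight_pos[of c s]]] by (simp add: abs_mult)
qed measurable

text \<open>Exchanging the order of integration over \<open>y\<close> and over the Laplace variable \<open>s\<close>.\<close>

lemma adjoint_forcing:
  assumes "1 / 2 \<le> c"
  shows "set_integrable lborel {1<..} (\<lambda>y. adjoint_solution c y * forcing c y)"
    and "(LINT y:{1<..}|lborel. adjoint_solution c y * forcing c y) = limit_density c"
proof -
  define k where "k y s = (if 1 < y \<and> 0 < s then s\<^sup>2 * exp (- ((y - 1) * s)) * weight c s * forcing c y else 0)" for y s
  have [measurable]: "(\<lambda>z. k (fst z) (snd z)) \<in> borel_measurable (borel \<Otimes>\<^sub>M borel)"
    unfolding k_def by measurable
  have [measurable]: "(\<lambda>z. k (snd z) (fst z)) \<in> borel_measurable (borel \<Otimes>\<^sub>M borel)"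
    unfolding k_def by measurable
  have k0: "0 \<le> k y s" for y s
    by (simp add: k_def less_imp_le[OF weight_pos] forcing_nonneg)
  have adj: "ennreal (indicator {1<..} y *\<^sub>R (adjoint_solution c y * forcing c y)) = (\<integral>\<^sup>+s. ennreal (k y s) \<partial>lborel)" for y
  proof (cases "1 < y")
    case True
    have "(\<integral>\<^sup>+s. ennreal (k y s) \<partial>lborel) = (\<integral>\<^sup>+s. ennreal (s\<^sup>2 * exp (- ((y - 1) * s)) * weight c s * forcing c y) * indicator {0<..} s \<partial>lborel)"
      using True by (intro nn_integral_cong) (auto simp: k_def split: split_indicator)
    also have "\<dots> = (\<integral>\<^sup>+s. ennreal (s\<^sup>2 * exp (- ((y - 1) * s)) * weight c s * forcing c y) \<partial>half_line)"
      by (subst nn_integral_restrict_space) auto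
    also have "\<dots> = ennreal (\<integral>s. s\<^sup>2 * exp (- ((y - 1) * s)) * weight c s * forcing c y \<partial>half_line)"
      using adjoint_integrable[OF True]
      by (intro nn_integral_eq_integral integrable_mult_left) (auto simp: less_imp_le[OF weight_pos] forcing_nonneg)
    also have "\<dots> = ennreal (adjoint_solution c y * forcing c y)"
      using adjoint_integrable[OF True] by (simp add: adjoint_solution_def)
    finally show ?thesis
      using True by simp
  qed (simp add: k_def)
  have "(\<integral>\<^sup>+y. \<integral>\<^sup>+s. ennreal (k y s) \<partial>lborel \<partial>lborel) = (\<integral>\<^sup>+s. \<integral>\<^sup>+y. ennreal (k y s) \<partial>lborel \<partial>lborel)"
    by (rule lborel_pair.Fubini') measurable
  also have "\<dots> = (\<integral>\<^sup>+s. ennreal (weight c s * (1 + exp (- (c * s)) + exp (- ((2 * c - 1) * s))) / 2) * indicator {0<..} s \<partial>lborel)"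
  proof (intro nn_integral_cong)
    fix s :: real
    show "(\<integral>\<^sup>+y. ennreal (k y s) \<partial>lborel) = ennreal (weight c s * (1 + exp (- (c * s)) + exp (- ((2 * c - 1) * s))) / 2) * indicator {0<..} s"
    proof (cases "0 < s")
      case True
      have "(\<integral>\<^sup>+y. ennreal (k y s) \<partial>lborel) =
          (\<integral>\<^sup>+y. ennreal (s\<^sup>2 * exp s * weight c s) * (ennreal (forcing c y * exp (- (y * s))) * indicator {1..} y) \<partial>lborel)"
      proof (intro nn_integral_cong_AE AE_mp[OF AE_lborel_singleton[of 1] AE_I2] impI)
        fix y :: real assume "y \<noteq> 1"
        moreover have "exp (- ((y - 1) * s)) = exp s * exp (- (y * s))"
          by (simp add: exp_add[symmetric] algebra_simps)
        ultimately show "ennreal (k y s) = ennreal (s\<^sup>2 * exp s * weight c s) * (ennreal (forcing c y * exp (- (y * s))) * indicator {1..} y)"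
          using True by (auto simp: k_def ennreal_mult[symmetric] less_imp_le[OF weight_pos] forcing_nonneg mult_ac split: split_indicator)
      qed
      also have "\<dots> = ennreal (s\<^sup>2 * exp s * weight c s) * ennreal ((exp (- s) + exp (- ((1 + c) * s)) + exp (- (2 * c * s))) / (2 * s\<^sup>2))"
        using assms True by (subst nn_integral_cmult) (auto simp: nn_integral_forcing_exp)
      finally have "(\<integral>\<^sup>+y. ennreal (k y s) \<partial>lborel) = ennreal (s\<^sup>2 * exp s * weight c s) * ennreal ((exp (- s) + exp (- ((1 + c) * s)) + exp (- (2 * c * s))) / (2 * s\<^sup>2))" .
      moreover have "\<dots> = ennreal (weight c s * (exp s * exp (- s) + exp s * exp (- ((1 + c) * s)) + exp s * exp (- (2 * c * s))) / 2)"
        using True by (simp add: ennreal_mult[symmetric] less_imp_le[OF weight_pos] add_nonneg_nonneg)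
          (simp add: field_simps)
      moreover have "exp s * exp (- s) = 1" "exp s * exp (- ((1 + c) * s)) = exp (- (c * s))" "exp s * exp (- (2 * c * s)) = exp (- ((2 * c - 1) * s))"
        by (simp_all add: exp_add[symmetric] algebra_simps)
      ultimately show ?thesis
        using True by simp
    qed (simp add: k_def)
  qed
  also have "\<dots> = (\<integral>\<^sup>+s. ennreal (weight c s * (1 + exp (- (c * s)) + exp (- ((2 * c - 1) * s))) / 2) \<partial>half_line)"
    by (subst nn_integral_restrict_space) auto
  also have "\<dots> = ennreal (\<integral>s. weight c s * (1 + exp (- (c * s)) + exp (- ((2 * c - 1) * s))) / 2 \<partial>half_line)"
    using limit_density_integrable[OF assms]
    by (intro nn_integral_eq_integral) (auto simp: less_imp_le[OF weight_pos] add_nonneg_nonneg)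
  also have "\<dots> = ennreal (limit_density c)"
    by (simp add: limit_density_def)
  finally have *: "(\<integral>\<^sup>+y. ennreal (indicator {1<..} y *\<^sub>R (adjoint_solution c y * forcing c y)) \<partial>lborel) = ennreal (limit_density c)"
    by (simp only: adj)
  have m: "(\<lambda>y. indicator {1<..} y *\<^sub>R (adjoint_solution c y * forcing c y)) \<in> borel_measurable lborel"
  proof -
    have "(\<lambda>y. (\<integral>\<^sup>+s. ennreal (k y s) \<partial>lborel)) \<in> borel_measurable borel"
      by measurable
    then have "(\<lambda>y. enn2real (ennreal (indicator {1<..} y *\<^sub>R (adjoint_solution c y * forcing c y)))) \<in> borel_measurable borel"
      unfolding adj by measurable
    then show ?thesis
      by (simp add: adjoint_nonneg forcing_nonneg)
  qed
  have ld: "0 \<le> limit_density c"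
    unfolding limit_density_def
    by (intro divide_nonneg_nonneg Bochner_Integration.integral_nonneg) (auto simp: less_imp_le[OF weight_pos] add_nonneg_nonneg)
  have "has_bochner_integral lborel (\<lambda>y. indicator {1<..} y *\<^sub>R (adjoint_solution c y * forcing c y)) (limit_density c)"
    by (rule has_bochner_integral_nn_integral[OF m _ ld *]) (simp add: adjoint_nonneg forcing_nonneg)
  then show "set_integrable lborel {1<..} (\<lambda>y. adjoint_solution c y * forcing c y)"
    and "(LINT y:{1<..}|lborel. adjoint_solution c y * forcing c y) = limit_density c"
    by (auto simp: set_integrable_def set_lebesgue_integral_def has_bochner_integral_iff)
qed

text \<open>The delay equation satisfied by \<open>\<eta>\<close>, together with the initial values and a linear bound.\<close>

locale delay =
  fixes c :: real and f :: "real \<Rightarrow> real"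
  assumes c: "1 / 2 \<le> c" "c \<le> 1"
    and integrable: "\<And>u v. f integrable_on {u..v}"
    and initial: "\<And>x. x < c \<Longrightarrow> f x = 0" "\<And>x. c \<le> x \<Longrightarrow> x < 1 \<Longrightarrow> f x = 1 / 2"
    and equation: "\<And>x. 1 < x \<Longrightarrow> (x - 1) * (f x - 1) = integral {0..x - 1} f + integral {0..x - c} f"
    and bounds: "\<And>x. 0 \<le> f x" "\<And>x. 0 \<le> x \<Longrightarrow> f x \<le> x / c"
begin

text \<open>The primitive of the solution, and its part that vanishes up to \<open>1\<close>.\<close>

definition N where "N x = integral {0..x} f"

definition H where "H x = N x - max 0 (x - c) / 2"

lemma continuous_N: "continuous_on UNIV N"
proof -
  have N0: "N x = 0" if "x \<le> 0" for x
    using that by (cases "x = 0") (auto simp: N_def)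
  have "continuous_on ({..0} \<union> {0..b}) N" for b
  proof (rule continuous_on_closed_Un)
    have "continuous_on {..0::real} (\<lambda>x. 0::real)"
      by simp
    then show "continuous_on {..0} N"
      by (rule continuous_on_cong[THEN iffD1, rotated -1]) (auto simp: N0)
    show "continuous_on {0..b} N"
      unfolding N_def using integrable by (intro indefinite_integral_continuous_1)
  qed auto
  then have *: "continuous_on {..<b} N" for b
    by (rule continuous_on_subset[where s = "{..0} \<union> {0..b}"]) auto
  have "isCont N x" for x
    using *[of "x + 1"] by (auto simp: continuous_on_eq_continuous_at)
  then show ?thesis
    by (simp add: continuous_on_eq_continuous_at)
qed

lemma continuous_H: "continuous_on UNIV H"
  unfolding H_def[abs_def] by (intro continuous_intros continuous_N) auto

lemma H_eq_0: "x \<le> 1 \<Longrightarrow> H x = 0"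
proof -
  have "N x = max 0 (x - c) / 2" if "x \<le> 1" for x
  proof (cases "x < c")
    case True
    then have "N x = integral {0..x} (\<lambda>_. 0)"
      unfolding N_def by (intro Henstock_Kurzweil_Integration.integral_cong initial) auto
    then show ?thesis using True by simp
  next
    case False
    have "integral {0..c} f = integral {0..c} (\<lambda>_. 0)"
      by (rule Henstock_Kurzweil_Integration.integral_spike[OF negligible_sing[of c]]) (auto simp: initial)
    moreover have "integral {c..x} f = integral {c..x} (\<lambda>_. 1 / 2)"
      using that by (intro Henstock_Kurzweil_Integration.integral_spike[OF negligible_sing[of 1]]) (auto simp: initial)
    moreover have "N x = integral {0..c} f + integral {c..x} f"
      unfolding N_def using False c by (intro Henstock_Kurzweil_Integration.integral_combine[symmetric] integrable) auto
    ultimately show ?thesis using False by simp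
  qed
  then show "x \<le> 1 \<Longrightarrow> H x = 0"
    by (simp add: H_def)
qed

lemma f_eq:
  assumes "1 < x"
  shows "f x = 1 + (N (x - 1) + N (x - c)) / (x - 1)"
  using equation[OF assms] assms by (simp add: N_def field_simps)

lemma f_eq_H:
  assumes "1 < x"
  shows "(x - 1) * (f x - 1 / 2) = forcing c x + H (x - 1) + H (x - c)"
proof -
  have "(x - 1) * (f x - 1) = N (x - 1) + N (x - c)"
    using equation[OF assms] by (simp add: N_def)
  then have "(x - 1) * (f x - 1 / 2) = (x - 1) / 2 + N (x - 1) + N (x - c)"
    by (simp add: algebra_simps)
  then show ?thesis
    using assms by (simp add: H_def forcing_def field_simps)
qed

lemma isCont_f:
  assumes "1 < x" shows "isCont f x"
proof -
  have [continuous_intros]: "isCont N y" for y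
    using continuous_N by (simp add: continuous_on_eq_continuous_at)
  have "isCont (\<lambda>x. 1 + (N (x - 1) + N (x - c)) / (x - 1)) x"
    using assms by (intro continuous_intros isCont_o2[where g = N]) auto
  moreover have "\<forall>\<^sub>F y in nhds x. 1 + (N (y - 1) + N (y - c)) / (y - 1) = f y"
    using assms f_eq by (intro eventually_nhds_in_open[of "{1<..}", THEN eventually_mono]) auto
  ultimately show ?thesis
    by (simp cong: isCont_cong)
qed

lemma has_derivative_N:
  assumes "1 < x"
  shows "(N has_real_derivative f x) (at x)"
proof -
  have "((\<lambda>u. integral {0..u} f) has_vector_derivative f x) (at x within {0..x + 1})"
    using integral_has_vector_derivative_continuous_at[of f 0 "x + 1" x "{}"] integrable assms
      continuous_at_imp_continuous_at_within[OF isCont_f[OF assms]] by simp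
  moreover have "at x within {0..x + 1} = at x"
    using assms by (intro at_within_interior) auto
  ultimately show ?thesis
    by (simp add: has_real_derivative_iff_has_vector_derivative N_def[abs_def])
qed

lemma has_derivative_H:
  assumes "1 < x"
  shows "(H has_real_derivative f x - 1 / 2) (at x)"
proof -
  have "((\<lambda>x. N x - (x - c) / 2) has_real_derivative f x - 1 / 2) (at x)"
    by (auto intro!: derivative_eq_intros has_derivative_N assms)
  moreover have "\<forall>\<^sub>F y in nhds x. N y - (y - c) / 2 = H y"
    using assms c by (intro eventually_nhds_in_open[of "{1<..}", THEN eventually_mono]) (auto simp: H_def)
  ultimately show ?thesis
    using DERIV_cong_ev[OF refl _ refl] by fast
qed

text \<open>
  The integrands of the two integrals over windows in the pairing below, which are used for
  \<open>d = 1\<close> and \<open>d = c\<close>, and their primitives. The cut at \<open>1\<close> avoids values of \<open>adjoint_solution c\<close> outside its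
  range; it does not change the product, as \<open>H\<close> vanishes there.
\<close>

definition w where "w d y = (if y \<le> 1 then 0 else adjoint_solution c (y + d) * H y)"

definition W where "W d x = integral {0..x} (w d)"

lemma continuous_w:
  assumes "1 / 2 \<le> d"
  shows "continuous_on UNIV (w d)"
proof -
  have "continuous_on ({..1} \<union> {1..}) (\<lambda>y. if y \<le> 1 then 0 else adjoint_solution c (y + d) * H y)"
  proof (rule continuous_on_If)
    have "continuous_on {1..} (\<lambda>y. adjoint_solution c (y + d))"
    proof (rule continuous_on_compose2[of "{1<..}" "adjoint_solution c"])
      show "continuous_on {1<..} (adjoint_solution c)"
        using isCont_adjoint[OF c(1)] by (intro continuous_at_imp_continuous_on) auto
    qed (use assms in \<open>auto intro!: continuous_intros\<close>)
    then show "continuous_on {1..} (\<lambda>y. adjoint_solution c (y + d) * H y)"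
      by (intro continuous_intros continuous_on_subset[OF continuous_H]) auto
  qed (auto simp: H_eq_0)
  moreover have "{..1} \<union> {1..} = (UNIV :: real set)"
    by auto
  ultimately show ?thesis
    by (simp add: w_def[abs_def])
qed

lemma w_integrable: "1 / 2 \<le> d \<Longrightarrow> w d integrable_on {u..v}"
  by (intro integrable_continuous_real continuous_on_subset[OF continuous_w]) auto

lemma has_derivative_W:
  assumes "1 / 2 \<le> d" "0 < x"
  shows "(W d has_real_derivative w d x) (at x)"
proof -
  have "((\<lambda>u. integral {0..u} (w d)) has_vector_derivative w d x) (at x within {0..x + 1})"
    using assms by (intro integral_has_vector_derivative continuous_on_subset[OF continuous_w]) auto
  moreover have "at x within {0..x + 1} = at x"
    using assms by (intro at_within_interior) auto
  ultimately show ?thesis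
    by (simp add: has_real_derivative_iff_has_vector_derivative W_def[abs_def])
qed

lemma W_eq_0: "1 / 2 \<le> d \<Longrightarrow> x \<le> 1 \<Longrightarrow> W d x = 0"
  unfolding W_def by (subst Henstock_Kurzweil_Integration.integral_cong[where g = "\<lambda>_. 0"]) (auto simp: w_def)

lemma continuous_W:
  assumes "1 / 2 \<le> d"
  shows "continuous_on {0..b} (W d)"
  unfolding W_def[abs_def] by (intro indefinite_integral_continuous_1 w_integrable assms)

text \<open>
  The pairing of the solution with the solution \<open>q\<close> of the adjoint equation:
  \<open>(x - 1) q(x) H(x)\<close> plus the integrals of \<open>q(y + 1) H(y)\<close> over \<open>[x - 1, x]\<close> and of
  \<open>q(y + c) H(y)\<close> over \<open>[x - c, x]\<close>. In its derivative all terms with \<open>H\<close> cancel.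
\<close>

definition Q where
  "Q x = adjoint_times c x * H x + (W 1 x - W 1 (x - 1)) + (W c x - W c (x - c))"

lemma has_derivative_Q:
  assumes "1 < x"
  shows "(Q has_real_derivative adjoint_solution c x * forcing c x) (at x)"
proof -
  have w: "w d x = adjoint_solution c (x + d) * H x" "w d (x - d) = adjoint_solution c x * H (x - d)" for d
    using assms H_eq_0 by (auto simp: w_def)
  have "(Q has_real_derivative (- adjoint_solution c (x + 1) - adjoint_solution c (x + c)) * H x + adjoint_times c x * (f x - 1 / 2)
      + (w 1 x - w 1 (x - 1)) + (w c x - w c (x - c))) (at x)"
    unfolding Q_def[abs_def] using assms c
    by (auto intro!: derivative_eq_intros has_derivative_adjoint_times has_derivative_H has_derivative_W
        DERIV_chain2[OF has_derivative_W])
  also have "(- adjoint_solution c (x + 1) - adjoint_solution c (x + c)) * H x + adjoint_times c x * (f x - 1 / 2)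
      + (w 1 x - w 1 (x - 1)) + (w c x - w c (x - c)) =
      adjoint_solution c x * ((x - 1) * (f x - 1 / 2) - H (x - 1) - H (x - c))"
    unfolding w adjoint_times_eq[OF c(1) assms] by (simp add: field_simps)
  also have "\<dots> = adjoint_solution c x * forcing c x"
    unfolding f_eq_H[OF assms] by simp
  finally show ?thesis .
qed

lemma Q_eq_integral:
  assumes "1 \<le> X"
  shows "((\<lambda>x. adjoint_solution c x * forcing c x) has_integral Q X) {1..X}"
proof -
  have "((\<lambda>x. adjoint_solution c x * forcing c x) has_integral Q X - Q 1) {1..X}"
  proof (rule fundamental_theorem_of_calculus_interior[OF assms])
    have "continuous_on {1..X} (adjoint_times c)"
      by (intro continuous_at_imp_continuous_on ballI DERIV_isCont[OF has_derivative_adjoint_times[OF c(1)]]) auto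
    moreover have "continuous_on {1..X} (W d)" if "1 / 2 \<le> d" "d \<le> 1" for d
      by (rule continuous_on_subset[OF continuous_W[OF that(1), of X]]) auto
    moreover have "continuous_on {1..X} (\<lambda>x. W d (x - d))" if "1 / 2 \<le> d" "d \<le> 1" for d
      by (rule continuous_on_compose2[OF continuous_W[OF that(1), of X]])
        (use that in \<open>auto intro!: continuous_intros\<close>)
    ultimately show "continuous_on {1..X} Q"
      unfolding Q_def[abs_def] using c
      by (intro continuous_intros continuous_on_subset[OF continuous_H]) auto
  qed (auto simp: has_real_derivative_iff_has_vector_derivative[symmetric] has_derivative_Q)
  moreover have "Q 1 = 0"
    using c by (simp add: Q_def H_eq_0 W_eq_0)
  ultimately show ?thesis by simp
qed

lemma tendsto_Q: "(Q \<longlongrightarrow> limit_density c) at_top"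
proof -
  let ?g = "\<lambda>x. indicator {1<..} x *\<^sub>R (adjoint_solution c x * forcing c x)"
  have "((\<lambda>y. LINT x|lborel. indicator {..y} x *\<^sub>R ?g x) \<longlongrightarrow> (LINT x|lborel. ?g x)) at_top"
    using adjoint_forcing(1)[OF c(1)] by (intro tendsto_integral_at_top) (auto simp: set_integrable_def)
  moreover have "(LINT x|lborel. ?g x) = limit_density c"
    using adjoint_forcing(2)[OF c(1)] by (simp add: set_lebesgue_integral_def)
  moreover have "\<forall>\<^sub>F y in at_top. (LINT x|lborel. indicator {..y} x *\<^sub>R ?g x) = Q y"
    using eventually_ge_at_top[of 1]
  proof eventually_elim
    case (elim y)
    have s: "set_integrable lborel {1<..y} (\<lambda>x. adjoint_solution c x * forcing c x)"
      by (rule set_integrable_subset[OF adjoint_forcing(1)[OF c(1)]]) auto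
    have "(LINT x|lborel. indicator {..y} x *\<^sub>R ?g x) = (LINT x:{1<..y}|lborel. adjoint_solution c x * forcing c x)"
      unfolding set_lebesgue_integral_def
      by (intro Bochner_Integration.integral_cong) (auto split: split_indicator)
    also have "\<dots> = integral {1<..y} (\<lambda>x. adjoint_solution c x * forcing c x)"
      by (rule set_borel_integral_eq_integral(2)[OF s])
    also have "\<dots> = integral {1..y} (\<lambda>x. adjoint_solution c x * forcing c x)"
      by (rule integral_subset_negligible) (auto intro: negligible_subset[of "{1}"])
    also have "\<dots> = Q y"
      using Q_eq_integral[OF elim] by (rule integral_unique)
    finally show ?case .
  qed
  ultimately show ?thesis
    by (auto intro: Lim_transform_eventually)
qed

lemma N_le: "0 \<le> x \<Longrightarrow> 0 \<le> N x" "0 \<le> x \<Longrightarrow> N x \<le> 2 * x\<^sup>2"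
proof -
  assume x: "0 \<le> x"
  show "0 \<le> N x"
    unfolding N_def by (intro Henstock_Kurzweil_Integration.integral_nonneg integrable bounds)
  have "f y \<le> 2 * x" if "y \<in> {0..x}" for y
  proof -
    have "y / c \<le> 2 * y"
      using c that mult_right_mono[of "1 / 2" c y] by (simp add: divide_simps) (simp add: field_simps)
    then show ?thesis
      using bounds(2)[of y] that by auto
  qed
  then have "N x \<le> integral {0..x} (\<lambda>_. 2 * x)"
    unfolding N_def by (intro integral_le integrable integrable_const_ivl) auto
  then show "N x \<le> 2 * x\<^sup>2"
    using x by (simp add: power2_eq_square)
qed

lemma abs_H_le:
  assumes "1 \<le> x" shows "\<bar>H x\<bar> \<le> 3 * x\<^sup>2"
proof -
  have "x \<le> x\<^sup>2"
    using assms by (simp add: power2_eq_square)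
  moreover have "0 \<le> max 0 (x - c) / 2" "max 0 (x - c) / 2 \<le> x"
    using assms c by auto
  ultimately show ?thesis
    using N_le[of x] assms unfolding H_def by linarith
qed

lemma abs_window_le:
  assumes "1 / 2 \<le> d" "d \<le> 1" "3 \<le> x"
  shows "\<bar>W d x - W d (x - d)\<bar> \<le> 6 * x\<^sup>2 / (x - 1) ^ 3"
proof -
  have "W d (x - d) + integral {x - d..x} (w d) = W d x"
    unfolding W_def using assms by (intro Henstock_Kurzweil_Integration.integral_combine w_integrable) auto
  then have eq: "W d x - W d (x - d) = integral {x - d..x} (w d)"
    by simp
  have "norm (w d y) \<le> 6 * x\<^sup>2 / (x - 1) ^ 3" if y: "y \<in> {x - d..x}" for y
  proof -
    have "adjoint_solution c (y + d) \<le> 2 / (y + d - 1) ^ 3"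
      using assms y by (intro adjoint_le) auto
    also have "\<dots> \<le> 2 / (x - 1) ^ 3"
      using assms y by (intro divide_left_mono power_mono mult_pos_pos zero_less_power) auto
    finally have "adjoint_solution c (y + d) \<le> 2 / (x - 1) ^ 3" .
    moreover have "\<bar>H y\<bar> \<le> 3 * x\<^sup>2"
    proof (rule order_trans[OF abs_H_le])
      show "3 * y\<^sup>2 \<le> 3 * x\<^sup>2"
        using assms y by (auto intro: power_mono)
    qed (use assms y in auto)
    ultimately have "adjoint_solution c (y + d) * \<bar>H y\<bar> \<le> 2 / (x - 1) ^ 3 * (3 * x\<^sup>2)"
      using assms by (intro mult_mono) (auto simp: adjoint_nonneg)
    then show ?thesis
      using assms y by (auto simp: w_def abs_mult adjoint_nonneg)
  qed
  then have "norm (integral (cbox (x - d) x) (w d)) \<le> 6 * x\<^sup>2 / (x - 1) ^ 3 * measure lborel (cbox (x - d) x)"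
    using assms w_integrable[of d "x - d" x]
    by (intro has_integral_bound[OF _ integrable_integral]) auto
  also have "\<dots> \<le> 6 * x\<^sup>2 / (x - 1) ^ 3 * 1"
    using assms by (intro mult_left_mono) auto
  finally show ?thesis
    by (simp add: eq)
qed

lemma tendsto_window:
  assumes "1 / 2 \<le> d" "d \<le> 1"
  shows "((\<lambda>x. W d x - W d (x - d)) \<longlongrightarrow> 0) at_top"
proof (rule Lim_null_comparison)
  show "\<forall>\<^sub>F x in at_top. norm (W d x - W d (x - d)) \<le> 6 * x\<^sup>2 / (x - 1) ^ 3"
    using eventually_ge_at_top[of 3] by eventually_elim (use abs_window_le[OF assms] in auto)
  show "((\<lambda>x::real. 6 * x\<^sup>2 / (x - 1) ^ 3) \<longlongrightarrow> 0) at_top"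
    by real_asymp
qed

text \<open>
  The window integrals vanish at infinity and \<open>(x - 1) q(x)\<close> behaves like \<open>2 / x\<^sup>2\<close>, so the limit of the
  pairing determines the growth of \<open>N\<close>.
\<close>

lemma tendsto_N: "((\<lambda>x. N x / x\<^sup>2) \<longlongrightarrow> limit_density c / 2) at_top"
proof -
  have "((\<lambda>x. Q x - (W 1 x - W 1 (x - 1)) - (W c x - W c (x - c))) \<longlongrightarrow> limit_density c - 0 - 0) at_top"
    using c by (intro tendsto_diff[OF tendsto_diff[OF tendsto_Q tendsto_window] tendsto_window]) auto
  then have "((\<lambda>x. adjoint_times c x * H x) \<longlongrightarrow> limit_density c) at_top"
    by (simp add: Q_def)
  then have lim: "((\<lambda>x. (adjoint_times c x * H x) / (x\<^sup>2 * adjoint_times c x)) \<longlongrightarrow> limit_density c / 2) at_top"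
    using c by (intro tendsto_divide tendsto_adjoint_times) auto
  have "\<forall>\<^sub>F x in at_top. 1 < x\<^sup>2 * adjoint_times c x"
    using order_tendstoD(1)[OF tendsto_adjoint_times[OF c], of 1] by simp
  then have "\<forall>\<^sub>F x in at_top. (adjoint_times c x * H x) / (x\<^sup>2 * adjoint_times c x) = H x / x\<^sup>2"
    by eventually_elim auto
  with lim have "((\<lambda>x. H x / x\<^sup>2) \<longlongrightarrow> limit_density c / 2) at_top"
    by (rule Lim_transform_eventually)
  moreover have "((\<lambda>x. (x - c) / 2 / x\<^sup>2) \<longlongrightarrow> 0) at_top"
    by real_asymp
  ultimately have "((\<lambda>x. H x / x\<^sup>2 + (x - c) / 2 / x\<^sup>2) \<longlongrightarrow> limit_density c / 2 + 0) at_top"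
    by (rule tendsto_add)
  moreover have "\<forall>\<^sub>F x in at_top. H x / x\<^sup>2 + (x - c) / 2 / x\<^sup>2 = N x / x\<^sup>2"
    using eventually_gt_at_top[of 1]
    by eventually_elim (use c in \<open>simp add: H_def diff_divide_distrib\<close>)
  ultimately show ?thesis
    by (auto intro: Lim_transform_eventually)
qed

theorem tendsto_limit_density: "((\<lambda>x. f x / x) \<longlongrightarrow> limit_density c) at_top"
proof -
  have shifted: "((\<lambda>x. N (x - d) / (x - d)\<^sup>2 * ((x - d)\<^sup>2 / (x * (x - 1)))) \<longlongrightarrow> limit_density c / 2 * 1) at_top" for d
  proof (rule tendsto_mult)
    have "filterlim (\<lambda>x. x - d) at_top at_top"
      by real_asymp
    then show "((\<lambda>x. N (x - d) / (x - d)\<^sup>2) \<longlongrightarrow> limit_density c / 2) at_top"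
      by (rule filterlim_compose[OF tendsto_N])
    show "((\<lambda>x. (x - d)\<^sup>2 / (x * (x - 1))) \<longlongrightarrow> 1) at_top"
      by real_asymp
  qed
  have "((\<lambda>x::real. 1 / x) \<longlongrightarrow> 0) at_top"
    by real_asymp
  from tendsto_add[OF tendsto_add[OF this shifted[of 1]] shifted[of c]]
  have "((\<lambda>x. 1 / x + N (x - 1) / (x - 1)\<^sup>2 * ((x - 1)\<^sup>2 / (x * (x - 1)))
      + N (x - c) / (x - c)\<^sup>2 * ((x - c)\<^sup>2 / (x * (x - 1)))) \<longlongrightarrow> limit_density c) at_top"
    by simp
  moreover have "\<forall>\<^sub>F x in at_top. 1 / x + N (x - 1) / (x - 1)\<^sup>2 * ((x - 1)\<^sup>2 / (x * (x - 1)))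
      + N (x - c) / (x - c)\<^sup>2 * ((x - c)\<^sup>2 / (x * (x - 1))) = f x / x"
    using eventually_gt_at_top[of 1]
  proof eventually_elim
    case (elim x)
    then have "x - 1 \<noteq> 0" "x - c \<noteq> 0" "x \<noteq> 0"
      using c by auto
    then have "1 / x + N (x - 1) / (x - 1)\<^sup>2 * ((x - 1)\<^sup>2 / (x * (x - 1)))
      + N (x - c) / (x - c)\<^sup>2 * ((x - c)\<^sup>2 / (x * (x - 1))) = (1 + (N (x - 1) + N (x - c)) / (x - 1)) / x"
      by (simp add: divide_simps)
    then show ?case
      using f_eq[OF elim] by simp
  qed
  ultimately show ?thesis
    by (rule Lim_transform_eventually)
qed

end

section \<open>The sign of the slope of the density\<close>

text \<open>The coverage density as a function of \<open>c\<close>.\<close>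

definition coverage :: "real \<Rightarrow> real" where
  "coverage c = c * limit_density c"

text \<open>
  With \<open>r = 1 / c\<close>, \<open>slope r\<close> is the derivative of \<open>coverage c\<close> with respect to \<open>ln c\<close>, written as an
  integral over \<open>v = c u\<close>. This substitution makes the integrand monotone in \<open>r\<close>.
\<close>

definition slope_integrand :: "real \<Rightarrow> real \<Rightarrow> real" where
  "slope_integrand r v = exp (- Ein v - Ein (r * v)) *
     (exp (- v) * (1 + exp (- v) - v) + exp (- ((2 - r) * v)) * (exp (- v) - 2 * v))"

definition slope :: "real \<Rightarrow> real" where
  "slope r = (\<integral>v. slope_integrand r v \<partial>half_line) / 2"

text \<open>
  For \<open>y = r v\<close> the left-hand side has the sign of the derivative of \<open>slope_integrand\<close> in \<open>r\<close>; the condition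
  \<open>1 \<le> r \<le> 2\<close> becomes \<open>v \<le> y \<le> 2 v\<close>.
\<close>

lemma slope_inequality:
  fixes v y :: real
  assumes "0 < v" "v \<le> y" "y \<le> 2 * v"
  shows "- (1 - exp (- y)) * exp (- v) * (1 + exp (- v) - v)
    + exp (y - 2 * v) * (y - 1 + exp (- y)) * (exp (- v) - 2 * v) < 0"
proof -
  define X T E where "X = exp (- v)" "T = exp (y - 2 * v)" "E = exp (- y)"
  have X: "0 < X" "X < 1" "1 - v \<le> X" and T: "X \<le> T" "T \<le> 1" and E: "0 < E" "E < 1"
    using assms exp_ge_add_one_self[of "- v"] by (auto simp: X_T_E_def)
  have yE: "0 < y - 1 + E"
    using exp_minus_greater[of y] assms by (simp add: X_T_E_def)
  consider "X \<le> 2 * v" "v < 1 + X" | "2 * v < X" | "1 + X \<le> v"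
    by linarith
  then have "- (1 - E) * X * (1 + X - v) + T * (y - 1 + E) * (X - 2 * v) < 0"
  proof cases
    case 1
    \<comment> \<open>Both summands are nonpositive, the first one strictly negative.\<close>
    have "0 < (1 - E) * X * (1 + X - v)"
      using 1 X E by (intro mult_pos_pos) auto
    moreover have "T * (y - 1 + E) * (X - 2 * v) \<le> 0"
      using 1 X T yE by (intro mult_nonneg_nonpos mult_nonneg_nonneg) auto
    ultimately show ?thesis
      unfolding mult_minus_left by linarith
  next
    case 2
    \<comment> \<open>The second summand is positive. Here \<open>v < 1/2\<close>, hence \<open>y < 1\<close>, and \<open>1 + y \<le> exp y\<close> suffices.\<close>
    have y: "0 < y" "y < 1"
      using 2 X assms by auto
    have "E * (1 + y) \<le> 1"
      using exp_ge_add_one_self[of y] mult_left_mono[of "1 + y" "exp y" E] E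
      by (simp add: X_T_E_def exp_minus)
    moreover have "y * y < y * 1"
      using y by (intro mult_strict_left_mono) auto
    ultimately have "(1 + y) * (y - 1 + E) < (1 + y) * (1 - E)"
      by (simp add: algebra_simps)
    then have "y - 1 + E < 1 - E"
      using y by simp
    moreover have "T * (y - 1 + E) * (X - 2 * v) \<le> (1 * (y - 1 + E)) * X"
      using assms X T yE 2 by (intro mult_mono) auto
    moreover have "(1 - E) * X * 1 \<le> (1 - E) * X * (1 + X - v)"
      using X E 2 by (intro mult_left_mono) auto
    moreover have "(y - 1 + E) * X < (1 - E) * X" if "y - 1 + E < 1 - E"
      using that X by (intro mult_strict_right_mono) auto
    ultimately show ?thesis
      unfolding mult_minus_left by linarith
  next
    case 3
    \<comment> \<open>The first summand is nonnegative. By \<open>X \<le> T\<close> the claim reduces to \<open>0 \<le> 2 (v - 1)\<^sup>2\<close>.\<close>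
    have v: "1 < v"
      using 3 X by linarith
    have "(1 - E) * (3 * v - 2) \<le> 1 * (3 * v - 2)"
      using E v by (intro mult_right_mono) auto
    also have "\<dots> \<le> v * (2 * v - 1)"
      using zero_le_power2[of "v - 1"] by (simp add: power2_eq_square algebra_simps)
    also have "\<dots> \<le> y * (2 * v - 1)"
      using assms v by (intro mult_right_mono) auto
    finally have "(1 - E) * (v - 1) \<le> (y - 1 + E) * (2 * v - 1)"
      by (simp add: algebra_simps)
    moreover have "(1 - E) * (v - 1 - X) < (1 - E) * (v - 1)"
      using E X by (intro mult_strict_left_mono) auto
    moreover have "(y - 1 + E) * (2 * v - 1) \<le> (y - 1 + E) * (2 * v - X)"
      using yE X by (intro mult_left_mono) auto
    ultimately have "X * ((1 - E) * (v - 1 - X)) < X * ((y - 1 + E) * (2 * v - X))"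
      using X by (intro mult_strict_left_mono) auto
    also have "\<dots> \<le> T * ((y - 1 + E) * (2 * v - X))"
      using T yE X v by (intro mult_right_mono mult_nonneg_nonneg) auto
    finally show ?thesis
      by (simp add: algebra_simps)
  qed
  then show ?thesis
    by (simp add: X_T_E_def)
qed

lemma slope_integrand_strict_decreasing:
  assumes "1 \<le> r" "r < t" "t \<le> 2" "0 < v"
  shows "slope_integrand t v < slope_integrand r v"
proof (rule DERIV_neg_imp_decreasing[OF assms(2), of "\<lambda>r. slope_integrand r v"])
  fix x assume x: "r \<le> x" "x \<le> t"
  define y where "y = x * v"
  have "0 < x" "1 * v \<le> y" "y \<le> 2 * v"
    using x assms by (auto simp: y_def intro!: mult_right_mono)
  have eq: "- (w * (1 - E) * (P + T * S) / x) + w * (T * v * S) = w / x * (- (1 - E) * P + T * (y - 1 + E) * S)"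
    for w E P T S
    using \<open>0 < x\<close> by (simp add: y_def field_simps)
  have e: "exp (- ((2 - x) * v)) = exp (y - 2 * v)"
    by (simp add: y_def algebra_simps)
  have "((\<lambda>r. slope_integrand r v) has_real_derivative
      - (exp (- Ein v - Ein y) * (1 - exp (- y)) * (exp (- v) * (1 + exp (- v) - v) + exp (y - 2 * v) * (exp (- v) - 2 * v)) / x)
      + exp (- Ein v - Ein y) * (exp (y - 2 * v) * v * (exp (- v) - 2 * v))) (at x)"
    unfolding slope_integrand_def e[symmetric] unfolding y_def using \<open>0 < x\<close> assms(4)
    by (auto intro!: derivative_eq_intros)
  then have "((\<lambda>r. slope_integrand r v) has_real_derivative
      exp (- Ein v - Ein y) / x * (- (1 - exp (- y)) * exp (- v) * (1 + exp (- v) - v)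
        + exp (y - 2 * v) * (y - 1 + exp (- y)) * (exp (- v) - 2 * v))) (at x)"
    unfolding eq by (simp only: mult.assoc)
  moreover have "exp (- Ein v - Ein y) / x * (- (1 - exp (- y)) * exp (- v) * (1 + exp (- v) - v)
        + exp (y - 2 * v) * (y - 1 + exp (- y)) * (exp (- v) - 2 * v)) < 0"
    using slope_inequality[OF assms(4), of y] \<open>1 * v \<le> y\<close> \<open>y \<le> 2 * v\<close> \<open>0 < x\<close>
    by (intro mult_pos_neg) auto
  ultimately show "\<exists>z. ((\<lambda>r. slope_integrand r v) has_real_derivative z) (at x) \<and> z < 0"
    by blast
qed

lemma borel_measurable_slope_integrand [measurable]: "slope_integrand r \<in> borel_measurable borel"
  unfolding slope_integrand_def[abs_def] by measurable

lemma abs_slope_integrand_le: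
  assumes "1 \<le> r" "r \<le> t" "t < 2" "0 < v"
  shows "\<bar>slope_integrand r v\<bar> \<le> 3 * exp (- v) + v * exp (- v) + 2 * (v * exp (- ((2 - t) * v)))"
proof -
  have "exp (- Ein v - Ein (r * v)) \<le> 1"
    using Ein_nonneg[of v] Ein_nonneg[of "r * v"] by simp
  moreover have "\<bar>exp (- v) * (1 + exp (- v) - v) + exp (- ((2 - r) * v)) * (exp (- v) - 2 * v)\<bar>
      \<le> exp (- v) * (2 + v) + (exp (- v) + 2 * (v * exp (- ((2 - t) * v))))"
  proof -
    have "0 < exp (- v)" "exp (- v) < 1"
      using assms by auto
    then have "\<bar>1 + exp (- v) - v\<bar> \<le> 2 + v"
      using assms by linarith
    then have "\<bar>exp (- v) * (1 + exp (- v) - v)\<bar> \<le> exp (- v) * (2 + v)"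
      unfolding abs_mult by (intro mult_mono) auto
    moreover have "exp (- ((2 - r) * v)) \<le> exp (- ((2 - t) * v))" "exp (- ((2 - r) * v)) \<le> 1"
      using assms by auto
    then have "exp (- ((2 - r) * v)) * exp (- v) \<le> 1 * exp (- v)"
      "2 * v * exp (- ((2 - r) * v)) \<le> 2 * v * exp (- ((2 - t) * v))"
      using assms by (auto intro!: mult_right_mono mult_left_mono)
    moreover have "\<bar>exp (- ((2 - r) * v)) * (exp (- v) - 2 * v)\<bar>
        \<le> exp (- ((2 - r) * v)) * exp (- v) + 2 * v * exp (- ((2 - r) * v))"
      unfolding right_diff_distrib[of "exp (- ((2 - r) * v))"]
      by (rule order_trans[OF abs_triangle_ineq4]) (use assms in \<open>simp add: abs_mult mult_ac\<close>)
    ultimately show ?thesis by linarith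
  qed
  ultimately have "\<bar>slope_integrand r v\<bar> \<le> 1 * (exp (- v) * (2 + v) + (exp (- v) + 2 * (v * exp (- ((2 - t) * v)))))"
    unfolding slope_integrand_def abs_mult by (intro mult_mono) auto
  then show ?thesis
    by (simp add: algebra_simps)
qed

lemma slope_bound_integrable:
  "t < 2 \<Longrightarrow> integrable half_line (\<lambda>v. 3 * exp (- v) + v * exp (- v) + 2 * (v * exp (- ((2 - t) * v))))"
  using half_line_exp(1)[of 1] half_line_times_exp[of 1] half_line_times_exp[of "2 - t"] by auto

lemma slope_integrand_integrable:
  assumes "1 \<le> r" "r < 2"
  shows "integrable half_line (slope_integrand r)"
  by (rule half_line_integrable_bound[OF slope_bound_integrable[OF assms(2)]])
    (use assms abs_slope_integrand_le[of r r] in auto)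

lemma slope_strict_decreasing:
  assumes "1 \<le> r" "r < t" "t < 2"
  shows "slope t < slope r"
proof -
  have "integral\<^sup>L half_line (slope_integrand t) < integral\<^sup>L half_line (slope_integrand r)"
    using assms
    by (intro half_line_integral_less slope_integrand_integrable slope_integrand_strict_decreasing) auto
  then show ?thesis
    by (simp add: slope_def)
qed

text \<open>
  Subtracting the derivative of \<open>3 v exp(-v) weight 1 v\<close>, which integrates to \<open>0\<close>, from the integrand leaves
  the positive function \<open>4 exp(-v) (1 - exp(-v)) weight 1 v\<close>.
\<close>

lemma slope_1_pos: "0 < slope 1"
proof -
  define F where "F v = 3 * (v * exp (- v) * weight 1 v)" for v
  define p where "p v = 4 * (exp (- v) * (1 - exp (- v)) * weight 1 v)" for v
  have eq: "slope_integrand 1 v = exp (- v) * (1 + 2 * exp (- v) - 3 * v) * weight 1 v" for v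
    by (simp add: slope_integrand_def weight_def algebra_simps)
  have int_p: "integrable half_line p"
  proof (rule half_line_integrable_bound)
    show "integrable half_line (\<lambda>v. 4 * exp (- (1 * v)))"
      by (intro integrable_mult_right half_line_exp) simp
    fix v :: real assume "0 < v"
    then have "exp (- v) * (1 - exp (- v)) * weight 1 v \<le> exp (- v) * 1 * 1"
      by (intro mult_mono) (auto simp: weight_le_1 less_imp_le[OF weight_pos])
    then show "\<bar>p v\<bar> \<le> 4 * exp (- (1 * v))"
      using \<open>0 < v\<close> by (simp add: p_def abs_mult)
  qed (simp add: p_def[abs_def])
  have int_s: "integrable half_line (slope_integrand 1)"
    by (rule slope_integrand_integrable) auto
  have "(\<integral>v. slope_integrand 1 v - p v \<partial>half_line) = 0 - 0"
  proof (rule half_line_FTC[where F = F])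
    fix v :: real assume "0 < v"
    then show "(F has_real_derivative slope_integrand 1 v - p v) (at v)"
      unfolding F_def[abs_def] eq p_def
      by (auto intro!: derivative_eq_intros simp: field_simps)
    show "isCont (\<lambda>v. slope_integrand 1 v - p v) v"
      unfolding eq p_def
      by (rule continuous_on_interior[of UNIV]) (auto intro!: continuous_intros)
  next
    have "continuous_on UNIV F"
      unfolding F_def[abs_def] by (intro continuous_intros)
    then have "(F \<longlongrightarrow> F 0) (at 0)"
      by (metis UNIV_I continuous_on_def at_within_open open_UNIV)
    then have "(F \<longlongrightarrow> 0) (at 0)"
      by (simp add: F_def)
    then show "(F \<longlongrightarrow> 0) (at_right 0)"
      by (rule tendsto_within_subset) simp
    have "((\<lambda>v::real. 3 * (v * exp (- v))) \<longlongrightarrow> 0) at_top"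
      by real_asymp
    then show "(F \<longlongrightarrow> 0) at_top"
      by (rule Lim_null_comparison[rotated], intro eventually_mono[OF eventually_ge_at_top[of 0]])
        (auto simp: F_def abs_mult weight_le_1 intro!: mult_left_le)
  qed (use int_s int_p in \<open>rule Bochner_Integration.integrable_diff\<close>)
  then have "integral\<^sup>L half_line (slope_integrand 1) = integral\<^sup>L half_line p"
    using int_s int_p by simp
  moreover have "integral\<^sup>L half_line (\<lambda>_. 0) < integral\<^sup>L half_line p"
  proof (rule half_line_integral_less)
    show "0 < p v" if "0 < v" for v
      using that by (auto simp: p_def weight_pos intro!: mult_pos_pos)
  qed (use int_p in auto)
  ultimately show ?thesis
    by (simp add: slope_def)
qed

lemma slope_pos_near_1: "\<exists>r. 1 < r \<and> r < 2 \<and> 0 < slope r"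
proof -
  define X where "X n = 1 + 1 / (real n + 2)" for n
  have X: "1 \<le> X n" "X n \<le> 3 / 2" "1 < X n" "X n < 2" for n
    by (auto simp: X_def field_simps)
  have "X \<longlonglongrightarrow> 1"
    unfolding X_def by real_asymp
  have "(\<lambda>n. integral\<^sup>L half_line (slope_integrand (X n))) \<longlonglongrightarrow> integral\<^sup>L half_line (slope_integrand 1)"
  proof (rule integral_dominated_convergence)
    show "integrable half_line (\<lambda>v. 3 * exp (- v) + v * exp (- v) + 2 * (v * exp (- ((2 - 3 / 2) * v))))"
      by (rule slope_bound_integrable) simp
    show "AE v in half_line. (\<lambda>n. slope_integrand (X n) v) \<longlonglongrightarrow> slope_integrand 1 v"
    proof (rule AE_I2)
      fix v
      have "continuous_on UNIV (\<lambda>r. slope_integrand r v)"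
        unfolding slope_integrand_def by (intro continuous_intros)
      then show "(\<lambda>n. slope_integrand (X n) v) \<longlonglongrightarrow> slope_integrand 1 v"
        using \<open>X \<longlonglongrightarrow> 1\<close> by (rule continuous_on_tendsto_compose) auto
    qed
    show "AE v in half_line. norm (slope_integrand (X n) v) \<le> 3 * exp (- v) + v * exp (- v) + 2 * (v * exp (- ((2 - 3 / 2) * v)))" for n
      using abs_slope_integrand_le[OF X(1,2)[of n]] by (intro AE_I2) auto
  qed auto
  then have "(\<lambda>n. slope (X n)) \<longlonglongrightarrow> slope 1"
    unfolding slope_def by (intro tendsto_divide) auto
  then have "\<forall>\<^sub>F n in sequentially. 0 < slope (X n)"
    using slope_1_pos by (rule order_tendstoD)
  then obtain n where "0 < slope (X n)"
    by (auto simp: eventually_sequentially)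
  then show ?thesis
    using X[of n] by blast
qed

text \<open>
  As \<open>r\<close> tends to \<open>2\<close> the integrand approaches a function whose negative part is of order \<open>1 / v\<close>, so the
  integral tends to \<open>-\<infinity>\<close> like a logarithm.
\<close>

lemma slope_neg_near_2: "\<exists>r. 1 < r \<and> r < 2 \<and> slope r < 0"
proof -
  \<comment> \<open>The negative part contributes at least \<open>exp(-3) ln M\<close>, and the positive part at most \<open>3\<close>.\<close>
  define M :: real where "M = exp (4 * exp 3)"
  have M: "1 < M"
    by (simp add: M_def)
  define r where "r = 2 - 1 / M"
  have r: "1 < r" "r < 2"
    using M by (auto simp: r_def)
  have lb: "exp (- 3) * (1 / v) \<le> 2 * v * exp (- Ein v - Ein (r * v)) * exp (- ((2 - r) * v))"
    if v: "1 \<le> v" "v \<le> M" for v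
  proof -
    have "exp (- 1) * exp (- 1) \<le> (v * exp (- Ein v)) * (r * v * exp (- Ein (r * v)))"
      using v r mult_mono[of 1 r 1 v] by (intro mult_mono times_exp_Ein_ge) auto
    also have "\<dots> \<le> v * exp (- Ein v) * (2 * v * exp (- Ein (r * v)))"
      using v r by (intro mult_left_mono mult_right_mono) auto
    also have "\<dots> = v * (2 * v * exp (- Ein v - Ein (r * v)))"
      by (simp add: exp_diff exp_minus field_simps)
    finally have "exp (- 2) * (1 / v) \<le> 2 * v * exp (- Ein v - Ein (r * v))"
      using v by (simp add: exp_add[symmetric] field_simps)
    moreover have "exp (- 1) \<le> exp (- ((2 - r) * v))"
      using v M by (simp add: r_def)
    ultimately have "exp (- 2) * (1 / v) * exp (- 1) \<le> 2 * v * exp (- Ein v - Ein (r * v)) * exp (- ((2 - r) * v))"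
      by (rule mult_mono) (use v in auto)
    moreover have "exp (- 2) * exp (- 1) = exp (- 3 :: real)"
      by (simp add: exp_add[symmetric])
    ultimately show ?thesis
      by (metis mult.assoc mult.commute)
  qed
  have ub: "slope_integrand r v \<le> 3 * exp (- v) - exp (- 3) * (1 / v * indicator {1..M} v)" if v: "0 < v" for v
  proof -
    let ?w = "exp (- Ein v - Ein (r * v))" and ?B = "exp (- ((2 - r) * v))"
    have w: "0 < ?w" "?w \<le> 1"
      using Ein_nonneg[of v] Ein_nonneg[of "r * v"] by auto
    have B: "?B \<le> 1"
      using r v by simp
    have "exp (- v) < 1"
      using v by simp
    then have "1 + exp (- v) - v \<le> 2"
      using v by linarith
    then have "exp (- v) * (1 + exp (- v) - v) + ?B * exp (- v) \<le> exp (- v) * 2 + 1 * exp (- v)"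
      using B by (intro add_mono mult_left_mono mult_right_mono) auto
    then have "?w * (exp (- v) * (1 + exp (- v) - v) + ?B * exp (- v)) \<le> ?w * (3 * exp (- v))"
      using w by (intro mult_left_mono) auto
    also have "\<dots> \<le> 1 * (3 * exp (- v))"
      using w by (intro mult_right_mono) auto
    finally have 1: "?w * (exp (- v) * (1 + exp (- v) - v) + ?B * exp (- v)) \<le> 3 * exp (- v)"
      by simp
    have 2: "exp (- 3) * (1 / v * indicator {1..M} v) \<le> 2 * v * ?w * ?B"
      using lb[of v] v by (auto split: split_indicator)
    have "slope_integrand r v = ?w * (exp (- v) * (1 + exp (- v) - v) + ?B * exp (- v)) - 2 * v * ?w * ?B"
      by (simp add: slope_integrand_def algebra_simps)
    with 1 2 show ?thesis
      by linarith
  qed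
  have log: "has_bochner_integral lborel (\<lambda>v. 1 / v * indicator {1..M} v) (ln M - ln 1)"
    using M by (intro has_bochner_integral_FTC_Icc_real) (auto intro!: derivative_eq_intros continuous_intros)
  have "has_bochner_integral half_line (\<lambda>v. 1 / v * indicator {1..M} v) (ln M)"
  proof -
    have "(\<lambda>v. indicator {0<..} v *\<^sub>R (1 / v * indicator {1..M} v)) = (\<lambda>v. 1 / v * indicator {1..M} v :: real)"
      by (auto simp: fun_eq_iff split: split_indicator)
    with log show ?thesis
      by (simp add: has_bochner_integral_iff integrable_restrict_space integral_restrict_space)
  qed
  then have log': "integrable half_line (\<lambda>v. 1 / v * indicator {1..M} v)"
    "(\<integral>v. 1 / v * indicator {1..M} v \<partial>half_line) = 4 * exp 3"
    by (simp_all add: has_bochner_integral_iff M_def)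
  have e: "integrable half_line (\<lambda>v. exp (- v))" "(\<integral>v. exp (- v) \<partial>half_line) = 1"
    using half_line_exp[of 1] by auto
  have "integral\<^sup>L half_line (slope_integrand r) \<le> (\<integral>v. 3 * exp (- v) - exp (- 3) * (1 / v * indicator {1..M} v) \<partial>half_line)"
    using r ub log'(1) e(1)
    by (intro integral_mono slope_integrand_integrable Bochner_Integration.integrable_diff integrable_mult_right) auto
  also have "\<dots> = (\<integral>v. 3 * exp (- v) \<partial>half_line) - (\<integral>v. exp (- 3) * (1 / v * indicator {1..M} v) \<partial>half_line)"
    by (intro Bochner_Integration.integral_diff integrable_mult_right log'(1) e(1))
  also have "\<dots> = 3 - exp (- 3) * (4 * exp 3)"
    by (simp only: integral_mult_right_zero log'(2) e(2))
  also have "\<dots> < 0"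
    by (simp add: exp_minus field_simps)
  finally show ?thesis
    using r by (auto simp: slope_def)
qed

section \<open>The density has a unique minimum\<close>

text \<open>The integrand of \<open>2 coverage c\<close>.\<close>

definition coverage_integrand :: "real \<Rightarrow> real \<Rightarrow> real" where
  "coverage_integrand c s = c * weight c s * (1 + exp (- (c * s)) + exp (- ((2 * c - 1) * s)))"

lemma coverage_eq: "coverage c = (\<integral>s. coverage_integrand c s \<partial>half_line) / 2"
  by (simp add: coverage_def limit_density_def coverage_integrand_def mult.assoc)

lemma borel_measurable_coverage_integrand [measurable]: "coverage_integrand c \<in> borel_measurable borel"
  unfolding coverage_integrand_def[abs_def] by measurable

lemma coverage_integrand_integrable:
  "1 / 2 \<le> c \<Longrightarrow> integrable half_line (coverage_integrand c)"
  using limit_density_integrable[of c] by (simp add: coverage_integrand_def[abs_def] mult.assoc)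

lemma half_line_integral_scale:
  fixes f :: "real \<Rightarrow> real"
  assumes "0 < k"
  shows "integral\<^sup>L half_line f = k * (\<integral>s. f (k * s) \<partial>half_line)"
proof -
  have "integral\<^sup>L half_line f = (\<integral>s. indicator {0<..} s *\<^sub>R f s \<partial>lborel)"
    by (simp add: integral_restrict_space)
  also have "\<dots> = \<bar>k\<bar> *\<^sub>R (\<integral>s. indicator {0<..} (0 + k * s) *\<^sub>R f (0 + k * s) \<partial>lborel)"
    by (rule lborel_integral_real_affine) (use assms in auto)
  also have "(\<integral>s. indicator {0<..} (0 + k * s) *\<^sub>R f (0 + k * s) \<partial>lborel) = (\<integral>s. indicator {0<..} s *\<^sub>R f (k * s) \<partial>lborel)"
    using assms by (intro Bochner_Integration.integral_cong) (auto split: split_indicator simp: zero_less_mult_iff)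
  finally show ?thesis
    using assms by (simp add: integral_restrict_space)
qed

lemma has_derivative_coverage:
  assumes "1 / 2 < c" "c < 1"
  shows "(coverage has_real_derivative slope (1 / c) / c) (at c)"
proof -
  define d where "d = (c + 1 / 2) / 2"
  have d: "1 / 2 < d" "d < c"
    using assms by (auto simp: d_def)
  define k where "k c s = weight c s * (exp (- (c * s)) * (1 + exp (- (c * s)) - c * s)
    + exp (- ((2 * c - 1) * s)) * (exp (- (c * s)) - 2 * (c * s)))" for c s
  have "((\<lambda>c. \<integral>s. coverage_integrand c s \<partial>half_line) has_real_derivative (\<integral>s. k c s \<partial>half_line)) (at c)"
  proof (rule has_derivative_integral_dominated(1)[OF d(2) assms(2)])
    show "integrable half_line (coverage_integrand y)" if "d < y" for y
      using that d by (intro coverage_integrand_integrable) auto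
    show "k c \<in> borel_measurable half_line"
      unfolding k_def[abs_def] by measurable
    show "integrable half_line (\<lambda>s. 3 * exp (- (1 / 2 * s)) + s * exp (- (1 / 2 * s)) + 2 * (s * exp (- ((2 * d - 1) * s))))"
      using d by (intro Bochner_Integration.integrable_add integrable_mult_right half_line_exp(1) half_line_times_exp) auto
    fix y s assume s: "s \<in> space half_line" and y: "d < y" "y < 1"
    then have s0: "0 < s" and y0: "0 < y"
      using d by auto
    have "((\<lambda>c. coverage_integrand c s) has_real_derivative
      - (y * weight y s * ((1 - exp (- (y * s))) / y) * (1 + exp (- (y * s)) + exp (- ((2 * y - 1) * s))))
      + weight y s * (1 + exp (- (y * s)) + exp (- ((2 * y - 1) * s)))
      + y * weight y s * (- s * exp (- (y * s)) - 2 * s * exp (- ((2 * y - 1) * s)))) (at y)"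
      unfolding coverage_integrand_def weight_def using s0 y0
      by (auto intro!: derivative_eq_intros) (simp add: field_simps)
    also have "- (y * weight y s * ((1 - exp (- (y * s))) / y) * (1 + exp (- (y * s)) + exp (- ((2 * y - 1) * s))))
      + weight y s * (1 + exp (- (y * s)) + exp (- ((2 * y - 1) * s)))
      + y * weight y s * (- s * exp (- (y * s)) - 2 * s * exp (- ((2 * y - 1) * s))) = k y s"
    proof -
      have "- (y * W * ((1 - A) / y) * (1 + A + B)) + W * (1 + A + B) + y * W * (- s * A - 2 * s * B)
          = W * (A * (1 + A - y * s) + B * (A - 2 * (y * s)))" for W A B
      proof -
        have "y * W * ((1 - A) / y) = W * (1 - A)"
          using y0 by simp
        then show ?thesis
          by (simp only:) (simp add: algebra_simps)
      qed
      then show ?thesis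
        unfolding k_def .
    qed
    finally show "((\<lambda>c. coverage_integrand c s) has_real_derivative k y s) (at y)" .
    define A B where "A = exp (- (y * s))" "B = exp (- ((2 * y - 1) * s))"
    have "1 / 2 * s \<le> y * s" "(2 * d - 1) * s \<le> (2 * y - 1) * s" "y * s \<le> 1 * s"
      using y d s0 by (auto intro!: mult_right_mono)
    then have A: "0 < A" "A \<le> 1" "A \<le> exp (- (1 / 2 * s))" and B: "0 < B" "B \<le> exp (- ((2 * d - 1) * s))" "B \<le> 1"
      and ys: "0 \<le> y * s" "y * s \<le> s"
      using y d s0 y0 by (auto simp: A_B_def)
    have le: "A * A \<le> A * 1" "B * A \<le> 1 * A" "A * (y * s) \<le> exp (- (1 / 2 * s)) * s"
        "B * (y * s) \<le> exp (- ((2 * d - 1) * s)) * s"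
      using A B ys by (auto intro!: mult_mono)
    have ge: "0 \<le> A * A" "0 \<le> B * A" "0 \<le> A * (y * s)" "0 \<le> B * (y * s)"
      using A B ys by auto
    have "\<bar>A * (1 + A - y * s) + B * (A - 2 * (y * s))\<bar>
        \<le> 3 * exp (- (1 / 2 * s)) + s * exp (- (1 / 2 * s)) + 2 * (s * exp (- ((2 * d - 1) * s)))"
    proof -
      have "A * (1 + A - y * s) + B * (A - 2 * (y * s)) = A + A * A + B * A - A * (y * s) - 2 * (B * (y * s))"
        by (simp add: algebra_simps)
      then show ?thesis
        using A(1,3) le ge unfolding mult.commute[of s] mult_1_left mult_1_right by linarith
    qed
    then have "\<bar>k y s\<bar> \<le> 1 * (3 * exp (- (1 / 2 * s)) + s * exp (- (1 / 2 * s)) + 2 * (s * exp (- ((2 * d - 1) * s))))"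
      unfolding k_def A_B_def[symmetric] abs_mult by (intro mult_mono) (auto simp: weight_le_1)
    then show "\<bar>k y s\<bar> \<le> 3 * exp (- (1 / 2 * s)) + s * exp (- (1 / 2 * s)) + 2 * (s * exp (- ((2 * d - 1) * s)))"
      by simp
  qed
  moreover have "(\<integral>s. k c s \<partial>half_line) = (1 / c) * (\<integral>v. slope_integrand (1 / c) v \<partial>half_line)"
  proof -
    have "k c (1 / c * v) = slope_integrand (1 / c) v" for v
    proof -
      have "(2 * c - 1) * (1 / c * v) = (2 - 1 / c) * v" "c * (1 / c * v) = v"
        using assms by (simp_all add: field_simps)
      moreover have "- Ein (1 / c * v) - Ein v = - Ein v - Ein (1 / c * v)"
        by simp
      ultimately show ?thesis
        unfolding k_def slope_integrand_def weight_def by (simp only:)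
    qed
    then show ?thesis
      using half_line_integral_scale[of "1 / c" "k c"] assms by simp
  qed
  ultimately have "((\<lambda>c. (\<integral>s. coverage_integrand c s \<partial>half_line) / 2) has_real_derivative
      ((1 / c) * (\<integral>v. slope_integrand (1 / c) v \<partial>half_line)) / 2) (at c)"
    by (auto intro!: derivative_eq_intros)
  moreover have "coverage = (\<lambda>c. (\<integral>s. coverage_integrand c s \<partial>half_line) / 2)"
    using coverage_eq by (intro ext)
  ultimately show ?thesis
    by (simp add: slope_def field_simps)
qed

lemma continuous_coverage: "continuous_on {1 / 2..1} coverage"
  unfolding continuous_on_sequentially comp_def
proof (intro ballI allI impI, elim conjE)
  fix c X assume c: "c \<in> {1 / 2..1}" and X: "\<forall>n. X n \<in> {1 / 2..1::real}" "X \<longlonglongrightarrow> c"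
  have "(\<lambda>n. integral\<^sup>L half_line (coverage_integrand (X n))) \<longlonglongrightarrow> integral\<^sup>L half_line (coverage_integrand c)"
  proof (rule integral_dominated_convergence)
    show "integrable half_line (\<lambda>s. weight (1 / 2) s * 3)"
      by (intro integrable_mult_left weight_integrable) simp
    show "AE s in half_line. (\<lambda>n. coverage_integrand (X n) s) \<longlonglongrightarrow> coverage_integrand c s"
    proof (rule AE_I2)
      fix s
      have "continuous_on UNIV (\<lambda>c. coverage_integrand c s)"
        unfolding coverage_integrand_def weight_def by (intro continuous_intros)
      then show "(\<lambda>n. coverage_integrand (X n) s) \<longlonglongrightarrow> coverage_integrand c s"
        using X(2) by (rule continuous_on_tendsto_compose) auto
    qed
    show "AE s in half_line. norm (coverage_integrand (X n) s) \<le> weight (1 / 2) s * 3" for n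
    proof (rule AE_I2)
      fix s assume "s \<in> space half_line"
      then have s: "0 < s" by simp
      have x: "1 / 2 \<le> X n" "X n \<le> 1"
        using X(1) by auto
      have "1 / 2 * s \<le> X n * s"
        using x s by (intro mult_right_mono) auto
      then have w: "weight (X n) s \<le> weight (1 / 2) s"
        using Ein_mono[of "1 / 2 * s" "X n * s"] by (simp add: weight_def)
      have "exp (- (X n * s)) \<le> 1" "exp (- ((2 * X n - 1) * s)) \<le> 1"
        using x s by auto
      then have "1 + exp (- (X n * s)) + exp (- ((2 * X n - 1) * s)) \<le> 3"
        by linarith
      then have "X n * weight (X n) s * (1 + exp (- (X n * s)) + exp (- ((2 * X n - 1) * s))) \<le> 1 * weight (1 / 2) s * 3"
        using x w by (intro mult_mono) (auto simp: less_imp_le[OF weight_pos] intro!: mult_nonneg_nonneg add_nonneg_nonneg)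
      then show "norm (coverage_integrand (X n) s) \<le> weight (1 / 2) s * 3"
        using x by (simp add: coverage_integrand_def abs_mult)
    qed
  qed auto
  then show "(\<lambda>n. coverage (X n)) \<longlonglongrightarrow> coverage c"
    unfolding coverage_eq by (intro tendsto_divide) auto
qed

text \<open>
  If the derivative is a positive function times a strictly increasing function that takes both signs, then
  the minimum is attained at exactly one point, in the interior.
\<close>

lemma unique_minimum_of_increasing_sign:
  fixes F g h :: "real \<Rightarrow> real"
  assumes "l < u" and cont: "continuous_on {l..u} F"
    and deriv: "\<And>x. l < x \<Longrightarrow> x < u \<Longrightarrow> (F has_real_derivative g x * h x) (at x)"
    and h: "\<And>x. l < x \<Longrightarrow> x < u \<Longrightarrow> 0 < h x"
    and g: "\<And>x y. l < x \<Longrightarrow> x < y \<Longrightarrow> y < u \<Longrightarrow> g x < g y"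
    and neg: "\<exists>p. l < p \<and> p < u \<and> g p < 0" and pos: "\<exists>q. l < q \<and> q < u \<and> 0 < g q"
  shows "\<exists>x. l < x \<and> x < u \<and> (\<forall>y\<in>{l..u}. F x \<le> F y) \<and> (\<forall>y\<in>{l..u}. F y = F x \<longrightarrow> y = x)"
proof -
  have inc: "F x < F y" if "l \<le> x" "x < y" "y \<le> u" "\<And>z. x < z \<Longrightarrow> z < y \<Longrightarrow> 0 < g z" for x y
  proof (rule DERIV_pos_imp_increasing_open[OF that(2)])
    fix z assume z: "x < z" "z < y"
    then have "(F has_real_derivative g z * h z) (at z)" "0 < g z * h z"
      using that by (auto intro!: deriv mult_pos_pos h)
    then show "\<exists>d. (F has_real_derivative d) (at z) \<and> 0 < d" by blast
  qed (use that in \<open>auto intro: continuous_on_subset[OF cont]\<close>)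
  have dec: "F y < F x" if "l \<le> x" "x < y" "y \<le> u" "\<And>z. x < z \<Longrightarrow> z < y \<Longrightarrow> g z < 0" for x y
  proof (rule DERIV_neg_imp_decreasing_open[OF that(2)])
    fix z assume z: "x < z" "z < y"
    then have "(F has_real_derivative g z * h z) (at z)" "g z * h z < 0"
      using that by (auto intro!: deriv mult_neg_pos h)
    then show "\<exists>d. (F has_real_derivative d) (at z) \<and> d < 0" by blast
  qed (use that in \<open>auto intro: continuous_on_subset[OF cont]\<close>)
  obtain x where x: "x \<in> {l..u}" "\<forall>y\<in>{l..u}. F x \<le> F y"
    using continuous_attains_inf[OF _ _ cont] assms(1) by auto
  have "x \<noteq> l"
  proof
    assume "x = l"
    obtain p where p: "l < p" "p < u" "g p < 0"
      using neg by blast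
    have "F p < F l"
      using p by (intro dec) (auto intro: less_trans[OF g])
    moreover have "F x \<le> F p"
      using x p by auto
    ultimately show False
      using \<open>x = l\<close> by simp
  qed
  moreover have "x \<noteq> u"
  proof
    assume "x = u"
    obtain q where q: "l < q" "q < u" "0 < g q"
      using pos by blast
    have "F q < F u"
      using q by (intro inc) (auto intro: less_trans[OF _ g])
    moreover have "F x \<le> F q"
      using x q by auto
    ultimately show False
      using \<open>x = u\<close> by simp
  qed
  moreover have no_two: False if "l \<le> y" "y < z" "z \<le> u" "\<forall>t\<in>{l..u}. F y \<le> F t" "\<forall>t\<in>{l..u}. F z \<le> F t" for y z
  proof -
    define m where "m = (y + z) / 2"
    have m: "y < m" "m < z" "l < m" "m < u"
      using that by (auto simp: m_def)
    show False
    proof (cases "0 \<le> g m")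
      case True
      have "F m < F z"
        using m that True by (intro inc) (auto intro: le_less_trans[OF _ g])
      moreover have "F z \<le> F m"
        using that(5) m by auto
      ultimately show False by simp
    next
      case False
      have "F m < F y"
        using m that False by (intro dec) (auto intro: less_trans[OF g])
      moreover have "F y \<le> F m"
        using that(4) m by auto
      ultimately show False by simp
    qed
  qed
  have "\<forall>y\<in>{l..u}. F y = F x \<longrightarrow> y = x"
  proof (intro ballI impI, rule ccontr)
    fix y assume y: "y \<in> {l..u}" "F y = F x" "y \<noteq> x"
    then consider "y < x" | "x < y" by linarith
    then show False
      using no_two[of y x] no_two[of x y] x y by cases auto
  qed
  ultimately show ?thesis
    using x by (intro exI[of _ x]) auto
qed

lemma unique_minimum_coverage:
  "\<exists>x. 1 / 2 < x \<and> x < 1 \<and> (\<forall>y\<in>{1 / 2..1}. coverage x \<le> coverage y)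
    \<and> (\<forall>y\<in>{1 / 2..1}. coverage y = coverage x \<longrightarrow> y = x)"
proof (rule unique_minimum_of_increasing_sign[where g = "\<lambda>c. slope (1 / c)" and h = "\<lambda>c. 1 / c"])
  show "continuous_on {1 / 2..1} coverage"
    by (rule continuous_coverage)
  show "(coverage has_real_derivative slope (1 / x) * (1 / x)) (at x)" if "1 / 2 < x" "x < 1" for x
    using has_derivative_coverage[OF that] by simp
  show "slope (1 / x) < slope (1 / y)" if "1 / 2 < x" "x < y" "y < 1" for x y
    using that by (intro slope_strict_decreasing) (auto simp: field_simps)
  obtain r where r: "1 < r" "r < 2" "slope r < 0"
    using slope_neg_near_2 by blast
  then show "\<exists>p. 1 / 2 < p \<and> p < 1 \<and> slope (1 / p) < 0"
    by (intro exI[of _ "1 / r"]) (auto simp: field_simps)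
  obtain t where t: "1 < t" "t < 2" "0 < slope t"
    using slope_pos_near_1 by blast
  then show "\<exists>q. 1 / 2 < q \<and> q < 1 \<and> 0 < slope (1 / q)"
    by (intro exI[of _ "1 / t"]) (auto simp: field_simps)
qed auto

lemma xi_eq_coverage:
  assumes "0 \<le> b" "b \<le> 1"
  shows "xi 1 b = coverage ((1 + b) / 2)"
proof -
  let ?c = "(1 + b) / 2"
  interpret delay ?c "eta 1 b"
  proof
    show "eta 1 b integrable_on {u..v}" for u v
      using assms by (intro eta_integrable) auto
    show "eta 1 b x = 0" if "x < ?c" for x
      using assms that by (intro eta_initial) auto
    show "eta 1 b x = 1 / 2" if "?c \<le> x" "x < 1" for x
      using assms that by (intro eta_initial) auto
    show "(x - 1) * (eta 1 b x - 1) = integral {0..x - 1} (eta 1 b) + integral {0..x - ?c} (eta 1 b)" if "1 < x" for x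
      using assms that by (intro eta_equation) auto
    show "0 \<le> eta 1 b x" for x
      using assms by (intro eta_bounds) auto
    show "eta 1 b x \<le> x / ?c" if "0 \<le> x" for x
      using assms that by (intro eta_bounds) auto
  qed (use assms in auto)
  have "lam 1 b = limit_density ?c"
    unfolding lam_def by (rule tendsto_Lim[OF _ tendsto_limit_density]) simp
  then show ?thesis
    by (simp add: xi_def coverage_def)
qed

theorem lemma1p10:
  shows "\<exists>x\<in>{0<..<1}. xi 1 x = (INF z\<in>{0..1}. xi 1 z) \<and>
           (\<forall>y\<in>{0..1}. xi 1 y = (INF z\<in>{0..1}. xi 1 z) \<longrightarrow> y = x)"
proof -
  obtain c where c: "1 / 2 < c" "c < 1" "\<And>y. y \<in> {1 / 2..1} \<Longrightarrow> coverage c \<le> coverage y"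
    "\<And>y. y \<in> {1 / 2..1} \<Longrightarrow> coverage y = coverage c \<Longrightarrow> y = c"
    using unique_minimum_coverage by blast
  define x where "x = 2 * c - 1"
  have x: "0 < x" "x < 1" "(1 + x) / 2 = c"
    using c by (auto simp: x_def)
  have min: "xi 1 x \<le> xi 1 z" if "z \<in> {0..1}" for z
    using that x c(3)[of "(1 + z) / 2"] by (simp add: xi_eq_coverage)
  have inf: "(INF z\<in>{0..1}. xi 1 z) = xi 1 x"
    using x min by (intro cInf_eq_minimum) auto
  have "y = x" if "y \<in> {0..1}" "xi 1 y = xi 1 x" for y
    using that x c(4)[of "(1 + y) / 2"] by (simp add: xi_eq_coverage x_def)
  then show ?thesis
    unfolding inf using x by (intro bexI[of _ x]) auto
qed

end
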